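(* Let $G$ be an infinite torsion-generated virtually cyclic group, and suppose $G=A\ast_C B$ with $A,B$ finite and $[A:C]=[B:C]=2$. Suppose that the image of the natural map $N_G(C)\to\mathrm{Aut}(C)$ (given by conjugation) is equal to $\mathrm{Inn}(C)$. Then $G$ is first-order rigid; in fact, every finitely generated group $\mathrm{AE}$-equivalent to $G$ is isomorphic to $G$.
   Context: A group is torsion-generated if it is generated by elements of finite order. A finitely generated group $G$ is first-order rigid if every finitely generated group elementarily equivalent to $G$ is isomorphic to $G$. Two groups are $\mathrm{AE}$-equivalent if they satisfy the same first-order sentences of the form $\forall\bar x\exists\bar y\,\theta(\bar x,\bar y)$ with $\theta$ quantifier-free. *)

theory Defs
  imports "HOL-Algebra.Group_Action" "HOL-Algebra.Generated_Groups"
begin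

datatype gterm = GVar nat | GOne | GMul gterm gterm | GInv gterm

datatype gform =
    GEq gterm gterm | GFalse | GNot gform | GAnd gform gform | GOr gform gform
  | GEx nat gform | GAll nat gform

fun teval :: "('a, 'b) monoid_scheme \<Rightarrow> (nat \<Rightarrow> 'a) \<Rightarrow> gterm \<Rightarrow> 'a" where
  "teval G \<rho> (GVar i) = \<rho> i"
| "teval G \<rho> GOne = \<one>\<^bsub>G\<^esub>"
| "teval G \<rho> (GMul s t) = teval G \<rho> s \<otimes>\<^bsub>G\<^esub> teval G \<rho> t"
| "teval G \<rho> (GInv t) = inv\<^bsub>G\<^esub> (teval G \<rho> t)"

fun feval :: "('a, 'b) monoid_scheme \<Rightarrow> (nat \<Rightarrow> 'a) \<Rightarrow> gform \<Rightarrow> bool" where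
  "feval G \<rho> (GEq s t) = (teval G \<rho> s = teval G \<rho> t)"
| "feval G \<rho> GFalse = False"
| "feval G \<rho> (GNot \<phi>) = (\<not> feval G \<rho> \<phi>)"
| "feval G \<rho> (GAnd \<phi> \<psi>) = (feval G \<rho> \<phi> \<and> feval G \<rho> \<psi>)"
| "feval G \<rho> (GOr \<phi> \<psi>) = (feval G \<rho> \<phi> \<or> feval G \<rho> \<psi>)"
| "feval G \<rho> (GEx x \<phi>) = (\<exists>a\<in>carrier G. feval G (\<rho>(x := a)) \<phi>)"
| "feval G \<rho> (GAll x \<phi>) = (\<forall>a\<in>carrier G. feval G (\<rho>(x := a)) \<phi>)"

fun tvars :: "gterm \<Rightarrow> nat set" where
  "tvars (GVar i) = {i}"
| "tvars GOne = {}"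
| "tvars (GMul s t) = tvars s \<union> tvars t"
| "tvars (GInv t) = tvars t"

fun fvars :: "gform \<Rightarrow> nat set" where
  "fvars (GEq s t) = tvars s \<union> tvars t"
| "fvars GFalse = {}"
| "fvars (GNot \<phi>) = fvars \<phi>"
| "fvars (GAnd \<phi> \<psi>) = fvars \<phi> \<union> fvars \<psi>"
| "fvars (GOr \<phi> \<psi>) = fvars \<phi> \<union> fvars \<psi>"
| "fvars (GEx x \<phi>) = fvars \<phi> - {x}"
| "fvars (GAll x \<phi>) = fvars \<phi> - {x}"

fun qfree :: "gform \<Rightarrow> bool" where
  "qfree (GEq s t) = True"
| "qfree GFalse = True"
| "qfree (GNot \<phi>) = qfree \<phi>"
| "qfree (GAnd \<phi> \<psi>) = (qfree \<phi> \<and> qfree \<psi>)"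
| "qfree (GOr \<phi> \<psi>) = (qfree \<phi> \<and> qfree \<psi>)"
| "qfree (GEx x \<phi>) = False"
| "qfree (GAll x \<phi>) = False"

definition sentence :: "gform \<Rightarrow> bool" where
  "sentence \<phi> \<longleftrightarrow> fvars \<phi> = {}"

text \<open>Truth of a formula in G: under every assignment of the variables into the carrier.
  For sentences this does not depend on the assignment.\<close>
definition holds :: "('a, 'b) monoid_scheme \<Rightarrow> gform \<Rightarrow> bool" where
  "holds G \<phi> \<longleftrightarrow> (\<forall>\<rho>. range \<rho> \<subseteq> carrier G \<longrightarrow> feval G \<rho> \<phi>)"

definition AE_sentence :: "gform \<Rightarrow> bool" where
  "AE_sentence \<phi> \<longleftrightarrow> sentence \<phi> \<and>
     (\<exists>xs ys \<theta>. qfree \<theta> \<and> \<phi> = foldr GAll xs (foldr GEx ys \<theta>))"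

definition elem_equiv :: "('a, 'b) monoid_scheme \<Rightarrow> ('c, 'd) monoid_scheme \<Rightarrow> bool" where
  "elem_equiv G H \<longleftrightarrow> (\<forall>\<phi>. sentence \<phi> \<longrightarrow> (holds G \<phi> \<longleftrightarrow> holds H \<phi>))"

definition AE_equiv :: "('a, 'b) monoid_scheme \<Rightarrow> ('c, 'd) monoid_scheme \<Rightarrow> bool" where
  "AE_equiv G H \<longleftrightarrow> (\<forall>\<phi>. AE_sentence \<phi> \<longrightarrow> (holds G \<phi> \<longleftrightarrow> holds H \<phi>))"

definition fin_gen :: "('a, 'b) monoid_scheme \<Rightarrow> bool" where
  "fin_gen G \<longleftrightarrow> (\<exists>S. finite S \<and> S \<subseteq> carrier G \<and> generate G S = carrier G)"

definition torsion_generated :: "('a, 'b) monoid_scheme \<Rightarrow> bool" where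
  "torsion_generated G \<longleftrightarrow>
     generate G {x \<in> carrier G. \<exists>n::nat. n > 0 \<and> x [^]\<^bsub>G\<^esub> n = \<one>\<^bsub>G\<^esub>} = carrier G"

definition virtually_cyclic :: "('a, 'b) monoid_scheme \<Rightarrow> bool" where
  "virtually_cyclic G \<longleftrightarrow> (\<exists>H. subgroup H G \<and> finite (rcosets\<^bsub>G\<^esub> H) \<and>
      (\<exists>h\<in>H. H = generate G {h}))"

definition sub_index :: "('a, 'b) monoid_scheme \<Rightarrow> 'a set \<Rightarrow> 'a set \<Rightarrow> nat" where
  "sub_index G A C = card (rcosets\<^bsub>G\<lparr>carrier := A\<rparr>\<^esub> C)"

text \<open>G is the (internal) amalgamated free product A *_C B: A, B are subgroups with
  A \<inter> B = C, and G is the pushout of A \<leftarrow> C \<rightarrow> B (universal property).  The target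
  groups K are taken with elements in nat; this loses nothing since the relevant
  targets (generated by the images of A and B, which are countable here) are countable.\<close>
definition amalgam :: "('a, 'b) monoid_scheme \<Rightarrow> 'a set \<Rightarrow> 'a set \<Rightarrow> 'a set \<Rightarrow> bool" where
  "amalgam G A B C \<longleftrightarrow> subgroup A G \<and> subgroup B G \<and> C = A \<inter> B \<and>
    (\<forall>(K :: nat monoid) f g. group K \<longrightarrow>
       f \<in> hom (G\<lparr>carrier := A\<rparr>) K \<longrightarrow> g \<in> hom (G\<lparr>carrier := B\<rparr>) K \<longrightarrow>
       (\<forall>c\<in>C. f c = g c) \<longrightarrow>
       (\<exists>h \<in> hom G K. (\<forall>a\<in>A. h a = f a) \<and> (\<forall>b\<in>B. h b = g b) \<and>
          (\<forall>h' \<in> hom G K. (\<forall>a\<in>A. h' a = f a) \<and> (\<forall>b\<in>B. h' b = g b) \<longrightarrow>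
             (\<forall>x\<in>carrier G. h' x = h x))))"

definition conj_image :: "('a, 'b) monoid_scheme \<Rightarrow> 'a set \<Rightarrow> ('a \<Rightarrow> 'a) set" where
  "conj_image G C = (\<lambda>g. \<lambda>x\<in>C. g \<otimes>\<^bsub>G\<^esub> x \<otimes>\<^bsub>G\<^esub> inv\<^bsub>G\<^esub> g) ` normalizer G C"

definition inner_auts :: "('a, 'b) monoid_scheme \<Rightarrow> 'a set \<Rightarrow> ('a \<Rightarrow> 'a) set" where
  "inner_auts G C = (\<lambda>c. \<lambda>x\<in>C. c \<otimes>\<^bsub>G\<^esub> x \<otimes>\<^bsub>G\<^esub> inv\<^bsub>G\<^esub> c) ` C"

end

theory Submission
  imports Defs "HOL-Algebra.Multiplicative_Group" "HOL-Library.Countable_Set"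
begin

text \<open>Since every element of \<open>G\<close> acts on \<open>C\<close> by an inner automorphism, there are \<open>a \<in> A - C\<close> and
  \<open>b \<in> B - C\<close> centralizing \<open>C\<close>. With \<open>t = a b\<close>, \<open>\<alpha> = a\<^sup>2\<close> and \<open>\<zeta> = a\<^sup>2 b\<^sup>2\<close> in \<open>Z(C)\<close>, the group \<open>G\<close> consists of
  the pairwise distinct elements \<open>c t\<^sup>k a\<^sup>e\<close> with \<open>e \<in> {0,1}\<close>, and \<open>a t a\<inverse> = \<zeta> t\<inverse>\<close>; so \<open>G\<close> is determined
  by \<open>(C, \<zeta>, \<alpha>)\<close>, and \<open>\<zeta>\<close> matters only up to squares of \<open>Z(C)\<close>.

  Let \<open>H\<close> be finitely generated and AE-equivalent to \<open>G\<close>. An \<open>\<exists>\<forall>\<close>-sentence yields a copy of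
  \<open>(C, t, a)\<close> in \<open>H\<close> such that the centralizer \<open>Z\<close> of \<open>t\<close> has index 2, its elements of exponent
  \<open>N = card C\<close> form \<open>C\<close>, and \<open>t\<^sup>N\<close> is not a \<open>2N\<close>-th power in \<open>Z\<close>. Further \<open>\<forall>\<exists>\<close>-sentences say that the
  \<open>N\<close>-th powers of \<open>Z\<close> form a torsion-free abelian group in which the squares have index at
  most 2. As this group is finitely generated, it is infinite cyclic, whence \<open>Z = C \<times> \<langle>s\<rangle>\<close> and
  \<open>t = c s\<^sup>k\<close> with \<open>k\<close> odd. Oddness gives \<open>a s a\<inverse> = \<gamma> s\<inverse>\<close> with \<open>\<gamma>\<close> congruent to \<open>\<zeta>\<close> modulo squares of \<open>Z(C)\<close>,
  so that multiplying \<open>s\<close> by an element of \<open>Z(C)\<close> reproduces the presentation of \<open>G\<close>.\<close>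

section \<open>Formulas and AE-equivalence\<close>

lemma teval_cong: "(\<And>i. i \<in> tvars s \<Longrightarrow> \<rho> i = \<sigma> i) \<Longrightarrow> teval G \<rho> s = teval G \<sigma> s"
  by (induction s) auto

lemma feval_cong: "(\<And>i. i \<in> fvars \<phi> \<Longrightarrow> \<rho> i = \<sigma> i) \<Longrightarrow> feval G \<rho> \<phi> = feval G \<sigma> \<phi>"
proof (induction \<phi> arbitrary: \<rho> \<sigma>)
  case (GEq s t)
  then show ?case using teval_cong[of s \<rho> \<sigma> G] teval_cong[of t \<rho> \<sigma> G] by auto
next
  case (GAnd \<phi> \<psi>)
  have "feval G \<rho> \<phi> = feval G \<sigma> \<phi>" "feval G \<rho> \<psi> = feval G \<sigma> \<psi>"
    by (rule GAnd.IH(1), use GAnd.prems in simp) (rule GAnd.IH(2), use GAnd.prems in simp)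
  then show ?case by simp
next
  case (GOr \<phi> \<psi>)
  have "feval G \<rho> \<phi> = feval G \<sigma> \<phi>" "feval G \<rho> \<psi> = feval G \<sigma> \<psi>"
    by (rule GOr.IH(1), use GOr.prems in simp) (rule GOr.IH(2), use GOr.prems in simp)
  then show ?case by simp
next
  case (GEx x \<phi>)
  have "feval G (\<rho>(x := a)) \<phi> = feval G (\<sigma>(x := a)) \<phi>" for a
    by (rule GEx.IH) (use GEx.prems in simp)
  then show ?case by simp
next
  case (GAll x \<phi>)
  have "feval G (\<rho>(x := a)) \<phi> = feval G (\<sigma>(x := a)) \<phi>" for a
    by (rule GAll.IH) (use GAll.prems in simp)
  then show ?case by simp
next
  case (GNot \<phi>)
  have "feval G \<rho> \<phi> = feval G \<sigma> \<phi>"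
    by (rule GNot.IH) (use GNot.prems in simp)
  then show ?case by simp
next
  case GFalse
  show ?case by simp
qed

lemma feval_foldr_GAll:
  "feval G \<rho> (foldr GAll xs \<phi>) \<longleftrightarrow>
    (\<forall>\<sigma>. (\<forall>i\<in>set xs. \<sigma> i \<in> carrier G) \<and> (\<forall>i. i \<notin> set xs \<longrightarrow> \<sigma> i = \<rho> i) \<longrightarrow> feval G \<sigma> \<phi>)"
proof (induction xs arbitrary: \<rho>)
  case Nil
  have "\<sigma> = \<rho>" if "\<forall>i. \<sigma> i = \<rho> i" for \<sigma> using that by auto
  then show ?case by auto
next
  case (Cons x xs)
  show ?case
  proof
    assume L: "feval G \<rho> (foldr GAll (x # xs) \<phi>)"
    show "\<forall>\<sigma>. (\<forall>i\<in>set (x # xs). \<sigma> i \<in> carrier G) \<and> (\<forall>i. i \<notin> set (x # xs) \<longrightarrow> \<sigma> i = \<rho> i) \<longrightarrow> feval G \<sigma> \<phi>"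
    proof (intro allI impI)
      fix \<sigma> assume s: "(\<forall>i\<in>set (x # xs). \<sigma> i \<in> carrier G) \<and> (\<forall>i. i \<notin> set (x # xs) \<longrightarrow> \<sigma> i = \<rho> i)"
      then have "feval G (\<rho>(x := \<sigma> x)) (foldr GAll xs \<phi>)" using L by simp
      then show "feval G \<sigma> \<phi>" unfolding Cons.IH using s by auto
    qed
  next
    assume R: "\<forall>\<sigma>. (\<forall>i\<in>set (x # xs). \<sigma> i \<in> carrier G) \<and> (\<forall>i. i \<notin> set (x # xs) \<longrightarrow> \<sigma> i = \<rho> i) \<longrightarrow> feval G \<sigma> \<phi>"
    have "feval G \<sigma> \<phi>" if "a \<in> carrier G" "\<forall>i\<in>set xs. \<sigma> i \<in> carrier G"
      "\<forall>i. i \<notin> set xs \<longrightarrow> \<sigma> i = (\<rho>(x := a)) i" for a \<sigma>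
    proof (rule R[rule_format], intro conjI ballI allI impI)
      fix i assume "i \<in> set (x # xs)"
      then show "\<sigma> i \<in> carrier G" using that by (cases "i \<in> set xs") auto
    next
      fix i assume "i \<notin> set (x # xs)"
      then show "\<sigma> i = \<rho> i" using that by auto
    qed
    then show "feval G \<rho> (foldr GAll (x # xs) \<phi>)" using Cons.IH by simp
  qed
qed

lemma feval_foldr_GEx:
  "feval G \<rho> (foldr GEx xs \<phi>) \<longleftrightarrow>
    (\<exists>\<sigma>. (\<forall>i\<in>set xs. \<sigma> i \<in> carrier G) \<and> (\<forall>i. i \<notin> set xs \<longrightarrow> \<sigma> i = \<rho> i) \<and> feval G \<sigma> \<phi>)"
proof -
  have "feval G \<rho> (foldr GEx xs \<phi>) = (\<not> feval G \<rho> (foldr GAll xs (GNot \<phi>)))" for \<rho>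
    by (induction xs arbitrary: \<rho>) auto
  then show ?thesis by (auto simp: feval_foldr_GAll)
qed

lemma fvars_foldr_GAll: "fvars (foldr GAll xs \<phi>) = fvars \<phi> - set xs"
  by (induction xs) auto

lemma fvars_foldr_GEx: "fvars (foldr GEx xs \<phi>) = fvars \<phi> - set xs"
  by (induction xs) auto

text \<open>Turns truth of the prefixed formula into a statement about total assignments. Values
  from \<open>n\<close> on are never read by \<open>\<theta>\<close>, so the witness
  \<open>\<tau>\<close> has to agree with \<open>\<sigma>\<close> only below
  \<open>m\<close>.\<close>

lemma holds_AE_closure:
  assumes "fvars \<theta> \<subseteq> {..<n}" "m \<le> n"
  shows "holds G (foldr GAll [0..<m] (foldr GEx [m..<n] \<theta>)) \<longleftrightarrow>
    (\<forall>\<sigma>. range \<sigma> \<subseteq> carrier G \<longrightarrow>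
      (\<exists>\<tau>. range \<tau> \<subseteq> carrier G \<and> (\<forall>i<m. \<tau> i = \<sigma> i) \<and> feval G \<tau> \<theta>))" (is "?L \<longleftrightarrow> ?R")
proof
  assume L: ?L
  show ?R
  proof (intro allI impI)
    fix \<sigma> :: "nat \<Rightarrow> 'a" assume s: "range \<sigma> \<subseteq> carrier G"
    then have "feval G \<sigma> (foldr GAll [0..<m] (foldr GEx [m..<n] \<theta>))"
      using L by (auto simp: holds_def)
    then have "feval G \<sigma> (foldr GEx [m..<n] \<theta>)"
      unfolding feval_foldr_GAll using s by (elim allE[of _ \<sigma>]) (simp add: range_subsetD)
    then obtain \<tau> where t: "\<forall>i\<in>set [m..<n]. \<tau> i \<in> carrier G"
      "\<forall>i. i \<notin> set [m..<n] \<longrightarrow> \<tau> i = \<sigma> i" "feval G \<tau> \<theta>"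
      unfolding feval_foldr_GEx by (elim exE conjE)
    have "\<tau> i \<in> carrier G" for i using t(1,2) s by (cases "i \<in> set [m..<n]") auto
    then show "\<exists>\<tau>. range \<tau> \<subseteq> carrier G \<and> (\<forall>i<m. \<tau> i = \<sigma> i) \<and> feval G \<tau> \<theta>"
      using t by (intro exI[of _ \<tau>]) (simp add: image_subset_iff)
  qed
next
  assume R: ?R
  show ?L
    unfolding holds_def feval_foldr_GAll feval_foldr_GEx
  proof (intro allI impI)
    fix \<rho> \<sigma> :: "nat \<Rightarrow> 'a"
    assume r: "range \<rho> \<subseteq> carrier G" and
      s: "(\<forall>i\<in>set [0..<m]. \<sigma> i \<in> carrier G) \<and> (\<forall>i. i \<notin> set [0..<m] \<longrightarrow> \<sigma> i = \<rho> i)"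
    have "\<sigma> i \<in> carrier G" for i using r s by (cases "i \<in> set [0..<m]") auto
    then have "range \<sigma> \<subseteq> carrier G" by (simp add: image_subset_iff)
    from R[rule_format, OF this] obtain \<tau> where
      t: "range \<tau> \<subseteq> carrier G" "\<forall>i<m. \<tau> i = \<sigma> i" "feval G \<tau> \<theta>"
      by (elim exE conjE)
    \<comment> \<open>Evaluation of the \<open>GEx\<close> prefix allows changes only in the
      existential block, so elsewhere the witness is reset to \<open>\<sigma>\<close>.\<close>
    let ?\<tau> = "\<lambda>i. if i \<in> {m..<n} then \<tau> i else \<sigma> i"
    have "?\<tau> i = \<tau> i" if "i \<in> fvars \<theta>" for i
      using assms(1) t(2) that by (cases "i < m") auto
    then have "feval G ?\<tau> \<theta> = feval G \<tau> \<theta>" by (rule feval_cong)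
    then show "\<exists>\<tau>. (\<forall>i\<in>set [m..<n]. \<tau> i \<in> carrier G) \<and> (\<forall>i. i \<notin> set [m..<n] \<longrightarrow> \<tau> i = \<sigma> i) \<and> feval G \<tau> \<theta>"
      using t(1,3) by (intro exI[of _ ?\<tau>]) (simp add: image_subset_iff)
  qed
qed

lemma AE_equiv_transfer:
  assumes "AE_equiv G H" "qfree \<theta>" "fvars \<theta> \<subseteq> {..<n}" "m \<le> n"
    and "\<And>\<sigma>. range \<sigma> \<subseteq> carrier G \<Longrightarrow>
      \<exists>\<tau>. range \<tau> \<subseteq> carrier G \<and> (\<forall>i<m. \<tau> i = \<sigma> i) \<and> feval G \<tau> \<theta>"
    and "range \<sigma> \<subseteq> carrier H"
  shows "\<exists>\<tau>. range \<tau> \<subseteq> carrier H \<and> (\<forall>i<m. \<tau> i = \<sigma> i) \<and> feval H \<tau> \<theta>"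
proof -
  let ?\<phi> = "foldr GAll [0..<m] (foldr GEx [m..<n] \<theta>)"
  have "fvars ?\<phi> = {}"
    using assms(3) by (force simp: fvars_foldr_GAll fvars_foldr_GEx)
  then have "AE_sentence ?\<phi>"
    unfolding AE_sentence_def sentence_def using assms(2) by blast
  moreover have "holds G ?\<phi>"
    using assms(5) holds_AE_closure[OF assms(3,4), of G] by simp
  ultimately have "holds H ?\<phi>"
    using assms(1) by (simp add: AE_equiv_def)
  then show ?thesis using holds_AE_closure[OF assms(3,4), of H] assms(6) by simp
qed

lemma AE_equiv_sym: "AE_equiv G H \<Longrightarrow> AE_equiv H G"
  by (simp add: AE_equiv_def)

text \<open>The negation of an \<open>\<exists>\<forall>\<close>-sentence is an
  \<open>\<forall>\<exists>\<close>-sentence. If no assignment worked in \<open>H\<close>, that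
  negation would hold in \<open>H\<close> and pass back to \<open>G\<close>.\<close>

lemma AE_equiv_transfer_EA:
  assumes "AE_equiv G H" "qfree \<theta>" "fvars \<theta> \<subseteq> {..<n}" "m \<le> n"
    and "range \<sigma> \<subseteq> carrier G"
    and "\<And>\<tau>. \<lbrakk>range \<tau> \<subseteq> carrier G; \<forall>i<m. \<tau> i = \<sigma> i\<rbrakk> \<Longrightarrow> feval G \<tau> \<theta>"
  shows "\<exists>\<sigma>. range \<sigma> \<subseteq> carrier H \<and>
    (\<forall>\<tau>. range \<tau> \<subseteq> carrier H \<and> (\<forall>i<m. \<tau> i = \<sigma> i) \<longrightarrow> feval H \<tau> \<theta>)"
proof (rule ccontr)
  assume c: "\<not> ?thesis"
  have "\<exists>\<tau>. range \<tau> \<subseteq> carrier G \<and> (\<forall>i<m. \<tau> i = \<sigma> i) \<and> feval G \<tau> (GNot \<theta>)"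
    by (rule AE_equiv_transfer[OF AE_equiv_sym[OF assms(1)] _ _ assms(4)])
      (use assms(2,3,5) c in auto)
  then show False using assms(6) by auto
qed

section \<open>Powers and derived connectives in the formula language\<close>

primrec gpow :: "gterm \<Rightarrow> nat \<Rightarrow> gterm" where
  "gpow s 0 = GOne"
| "gpow s (Suc n) = GMul (gpow s n) s"

lemma teval_gpow [simp]: "teval G \<rho> (gpow s n) = teval G \<rho> s [^]\<^bsub>G\<^esub> n"
  by (induction n) auto

lemma tvars_gpow [simp]: "tvars (gpow s n) = (if n = 0 then {} else tvars s)"
  by (induction n) auto

definition GImp :: "gform \<Rightarrow> gform \<Rightarrow> gform" where
  "GImp \<phi> \<psi> = GOr (GNot \<phi>) \<psi>"

definition GConj :: "gform list \<Rightarrow> gform" where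
  "GConj \<phi>s = foldr GAnd \<phi>s (GNot GFalse)"

definition GDisj :: "gform list \<Rightarrow> gform" where
  "GDisj \<phi>s = foldr GOr \<phi>s GFalse"

lemma feval_GImp [simp]: "feval G \<rho> (GImp \<phi> \<psi>) \<longleftrightarrow> (feval G \<rho> \<phi> \<longrightarrow> feval G \<rho> \<psi>)"
  by (auto simp: GImp_def)

lemma feval_GConj [simp]: "feval G \<rho> (GConj \<phi>s) \<longleftrightarrow> (\<forall>\<phi>\<in>set \<phi>s. feval G \<rho> \<phi>)"
  unfolding GConj_def by (induction \<phi>s) auto

lemma feval_GDisj [simp]: "feval G \<rho> (GDisj \<phi>s) \<longleftrightarrow> (\<exists>\<phi>\<in>set \<phi>s. feval G \<rho> \<phi>)"
  unfolding GDisj_def by (induction \<phi>s) auto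

lemma qfree_GImp [simp]: "qfree (GImp \<phi> \<psi>) \<longleftrightarrow> qfree \<phi> \<and> qfree \<psi>"
  by (auto simp: GImp_def)

lemma qfree_GConj [simp]: "qfree (GConj \<phi>s) \<longleftrightarrow> (\<forall>\<phi>\<in>set \<phi>s. qfree \<phi>)"
  unfolding GConj_def by (induction \<phi>s) auto

lemma qfree_GDisj [simp]: "qfree (GDisj \<phi>s) \<longleftrightarrow> (\<forall>\<phi>\<in>set \<phi>s. qfree \<phi>)"
  unfolding GDisj_def by (induction \<phi>s) auto

lemma fvars_GImp [simp]: "fvars (GImp \<phi> \<psi>) = fvars \<phi> \<union> fvars \<psi>"
  by (auto simp: GImp_def)

lemma fvars_GConj [simp]: "fvars (GConj \<phi>s) = (\<Union>\<phi>\<in>set \<phi>s. fvars \<phi>)"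
  unfolding GConj_def by (induction \<phi>s) auto

lemma fvars_GDisj [simp]: "fvars (GDisj \<phi>s) = (\<Union>\<phi>\<in>set \<phi>s. fvars \<phi>)"
  unfolding GDisj_def by (induction \<phi>s) auto

section \<open>Torsion-free abelian groups with few square classes\<close>

text \<open>An indexed family instead of a set, so that generators may repeat and each exponent
  belongs to a position that survives changes of generators.\<close>

definition (in comm_group) spans :: "nat set \<Rightarrow> (nat \<Rightarrow> 'a) \<Rightarrow> bool" where
  "spans I q \<longleftrightarrow> finite I \<and> q \<in> I \<rightarrow> carrier G \<and>
    (\<forall>x\<in>carrier G. \<exists>f :: nat \<Rightarrow> int. x = (\<Otimes>i\<in>I. q i [^] f i))"

context comm_group
begin

lemma finprod_pow_remove:
  assumes "finite I" "q \<in> I \<rightarrow> carrier G" "i \<in> I"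
  shows "(\<Otimes>k\<in>I. q k [^] (f k :: int)) = q i [^] f i \<otimes> (\<Otimes>k\<in>I - {i}. q k [^] f k)"
proof -
  have "(\<Otimes>k\<in>insert i (I - {i}). q k [^] f k) = q i [^] f i \<otimes> (\<Otimes>k\<in>I - {i}. q k [^] f k)"
    by (rule finprod_insert) (use assms in \<open>auto simp: Pi_def\<close>)
  then show ?thesis using assms(3) by (simp add: insert_absorb)
qed

lemma finprod_pow_mult:
  fixes f g :: "nat \<Rightarrow> int"
  assumes "q \<in> I \<rightarrow> carrier G"
  shows "(\<Otimes>i\<in>I. q i [^] f i) \<otimes> (\<Otimes>i\<in>I. q i [^] g i) = (\<Otimes>i\<in>I. q i [^] (f i + g i))"
proof -
  have "(\<Otimes>i\<in>I. q i [^] f i) \<otimes> (\<Otimes>i\<in>I. q i [^] g i) = (\<Otimes>i\<in>I. q i [^] f i \<otimes> q i [^] g i)"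
    using assms by (simp add: finprod_multf Pi_def)
  also have "\<dots> = (\<Otimes>i\<in>I. q i [^] (f i + g i))"
    by (rule finprod_cong) (use assms in \<open>auto simp: Pi_def simp_implies_def int_pow_mult\<close>)
  finally show ?thesis .
qed

text \<open>An elementary change of generators: the factor \<open>q i [^] (s * f j)\<close> gained
  at position \<open>j\<close> is taken off at position \<open>i\<close>.\<close>

lemma finprod_pow_shear:
  fixes f :: "nat \<Rightarrow> int" and s :: int
  assumes "finite I" "q \<in> I \<rightarrow> carrier G" "i \<in> I" "j \<in> I" "i \<noteq> j"
  shows "(\<Otimes>k\<in>I. q k [^] f k) =
    (\<Otimes>k\<in>I. (q(j := q j \<otimes> q i [^] s)) k [^] (f(i := f i - s * f j)) k)"
    (is "_ = (\<Otimes>k\<in>I. ?q k [^] ?f k)")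
proof -
  have q: "q i \<in> carrier G" "q j \<in> carrier G" using assms by auto
  have q': "?q \<in> I \<rightarrow> carrier G" using assms(2) q by (auto simp: Pi_def)
  let ?R = "\<Otimes>k\<in>I - {i} - {j}. q k [^] f k"
  have R: "?R \<in> carrier G" using assms by (intro finprod_closed) auto
  have R': "(\<Otimes>k\<in>I - {i} - {j}. ?q k [^] ?f k) = ?R"
    using assms by (intro finprod_cong) (auto simp: simp_implies_def Pi_def)
  have "(\<Otimes>k\<in>I. p k [^] g k) = p i [^] g i \<otimes> (p j [^] g j \<otimes> (\<Otimes>k\<in>I - {i} - {j}. p k [^] g k))"
    if "p \<in> I \<rightarrow> carrier G" for p and g :: "nat \<Rightarrow> int"
  proof -
    have "(\<Otimes>k\<in>I - {i}. p k [^] g k) = p j [^] g j \<otimes> (\<Otimes>k\<in>I - {i} - {j}. p k [^] g k)"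
      by (rule finprod_pow_remove) (use assms that in auto)
    then show ?thesis using finprod_pow_remove[OF assms(1) that assms(3)] by simp
  qed
  from this[OF assms(2), of f] this[OF q', of ?f]
  have "(\<Otimes>k\<in>I. q k [^] f k) = q i [^] f i \<otimes> (q j [^] f j \<otimes> ?R)"
    and "(\<Otimes>k\<in>I. ?q k [^] ?f k) = ?q i [^] ?f i \<otimes> (?q j [^] ?f j \<otimes> ?R)"
    by (simp_all only: R')
  moreover have "?q i [^] ?f i \<otimes> (?q j [^] ?f j \<otimes> ?R) =
      q i [^] (f i - s * f j) \<otimes> (q j [^] f j \<otimes> q i [^] (s * f j) \<otimes> ?R)"
    using assms q by (simp add: int_pow_distrib int_pow_pow)
  moreover have "\<dots> = q i [^] (f i - s * f j) \<otimes> q i [^] (s * f j) \<otimes> (q j [^] f j \<otimes> ?R)"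
    using q R by (simp add: m_ac)
  moreover have "q i [^] (f i - s * f j) \<otimes> q i [^] (s * f j) = q i [^] f i"
    using q by (simp add: int_pow_mult[symmetric])
  ultimately show ?thesis by simp
qed

text \<open>Euclid's algorithm on the exponents of a relation.\<close>
lemma spans_reduce:
  fixes e :: "nat \<Rightarrow> int"
  assumes tf: "\<forall>x\<in>carrier G. \<forall>n>0::nat. x [^] n = \<one> \<longrightarrow> x = \<one>"
  shows "\<lbrakk>spans I q; (\<Otimes>i\<in>I. q i [^] e i) = \<one>; i \<in> I; e i \<noteq> 0\<rbrakk>
    \<Longrightarrow> \<exists>J p. spans J p \<and> card J < card I"
proof (induction "\<Sum>i\<in>I. nat \<bar>e i\<bar>" arbitrary: e q i rule: less_induct)
  case less
  have I: "finite I" and q: "q \<in> I \<rightarrow> carrier G"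
    and gen: "\<And>x. x \<in> carrier G \<Longrightarrow> \<exists>f :: nat \<Rightarrow> int. x = (\<Otimes>i\<in>I. q i [^] f i)"
    using less.prems by (auto simp: spans_def)
  have qi: "q i \<in> carrier G" using q less.prems by auto
  show ?case
  proof (cases "\<exists>j\<in>I. j \<noteq> i \<and> e j \<noteq> 0")
    case False
    have "(\<Otimes>k\<in>I - {i}. q k [^] e k) = (\<Otimes>k\<in>I - {i}. \<one>)"
      by (rule finprod_cong) (use False in \<open>auto simp: simp_implies_def\<close>)
    then have "q i [^] e i = \<one>"
      using less.prems finprod_pow_remove[OF I q \<open>i \<in> I\<close>, of e] qi by simp
    then have "q i [^] \<bar>e i\<bar> = \<one>"
      using qi by (cases "e i \<ge> 0") (simp_all add: int_pow_neg)
    then have "q i [^] nat \<bar>e i\<bar> = \<one>"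
      by (metis abs_ge_zero int_nat_eq int_pow_int)
    then have 1: "q i = \<one>" using tf qi less.prems by (metis abs_eq_0 abs_ge_zero nat_0_iff neq0_conv order_antisym)
    have "spans (I - {i}) q"
      unfolding spans_def
    proof (intro conjI ballI)
      fix x assume "x \<in> carrier G"
      then obtain f :: "nat \<Rightarrow> int" where "x = (\<Otimes>i\<in>I. q i [^] f i)" using gen by blast
      then have "x = (\<Otimes>k\<in>I - {i}. q k [^] f k)"
        using finprod_pow_remove[OF I q \<open>i \<in> I\<close>, of f] 1 q
        by (simp add: Pi_def)
      then show "\<exists>f :: nat \<Rightarrow> int. x = (\<Otimes>k\<in>I - {i}. q k [^] f k)" by blast
    qed (use I q in auto)
    then show ?thesis using I \<open>i \<in> I\<close> by (meson card_Diff1_less)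
  next
    case True
    then obtain k l where kl: "k \<in> I" "l \<in> I" "k \<noteq> l" "e l \<noteq> 0" "\<bar>e l\<bar> \<le> \<bar>e k\<bar>"
      using less.prems by (metis linear)
    \<comment> \<open>With this sign the shear replaces \<open>\<bar>e k\<bar>\<close> by
      \<open>\<bar>e k\<bar> - \<bar>e l\<bar>\<close>, so the sum of absolute exponents decreases.
      The exponent at \<open>l\<close> is untouched and stays nonzero, as the induction hypothesis
      requires.\<close>
    define s where "s = sgn (e k) * sgn (e l)"
    define q' where "q' = q(l := q l \<otimes> q k [^] s)"
    define e' where "e' = e(k := e k - s * e l)"
    have ek: "\<bar>e k - s * e l\<bar> = \<bar>e k\<bar> - \<bar>e l\<bar>" "e k \<noteq> 0"
      using kl(4,5) by (auto simp: s_def sgn_if)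
    have shear: "(\<Otimes>j\<in>I. q j [^] f j) = (\<Otimes>j\<in>I. q' j [^] (f(k := f k - s * f l)) j)"
      for f :: "nat \<Rightarrow> int"
      unfolding q'_def by (rule finprod_pow_shear[OF I q kl(1-3)])
    have "(\<Sum>j\<in>I. nat \<bar>e' j\<bar>) < (\<Sum>j\<in>I. nat \<bar>e j\<bar>)"
      by (rule sum_strict_mono_ex1[OF I]) (use kl ek in \<open>auto simp: e'_def intro!: nat_mono bexI[of _ k]\<close>)
    moreover have "spans I q'"
      unfolding spans_def
    proof (intro conjI ballI)
      show "q' \<in> I \<rightarrow> carrier G" using q kl(1,2) by (auto simp: q'_def Pi_def)
      fix x assume "x \<in> carrier G"
      then show "\<exists>f :: nat \<Rightarrow> int. x = (\<Otimes>i\<in>I. q' i [^] f i)" using gen shear by metis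
    qed (rule I)
    moreover have "(\<Otimes>j\<in>I. q' j [^] e' j) = \<one>"
      using shear[of e] less.prems by (simp add: e'_def)
    moreover have "e' l \<noteq> 0" using kl by (simp add: e'_def)
    ultimately show ?thesis using less.hyps kl(2) by blast
  qed
qed

lemma spans_of_finite_generate:
  assumes "finite S" "S \<subseteq> carrier G" "generate G S = carrier G"
  shows "\<exists>I q. spans I q"
proof -
  obtain q :: "nat \<Rightarrow> 'a" and n where S: "S = q ` {..<n}"
    using finite_imp_nat_seg_image_inj_on[OF assms(1)] by (metis lessThan_def)
  then have q: "q \<in> {..<n} \<rightarrow> carrier G" using assms(2) by auto
  have single: "q i [^] (e::int) = (\<Otimes>k\<in>{..<n}. q k [^] (if k = i then e else 0))" if "i < n" for i e
  proof -
    have "(\<Otimes>k\<in>{..<n} - {i}. q k [^] (if k = i then e else 0)) = (\<Otimes>k\<in>{..<n} - {i}. \<one>)"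
      by (rule finprod_cong) (auto simp: simp_implies_def)
    then show ?thesis
      using that q by (subst finprod_pow_remove[of _ _ i]) (auto simp: Pi_def)
  qed
  have "\<exists>f :: nat \<Rightarrow> int. x = (\<Otimes>i\<in>{..<n}. q i [^] f i)" if "x \<in> generate G S" for x
    using that
  proof induction
    case one
    have "\<one> = (\<Otimes>i\<in>{..<n}. q i [^] (\<lambda>_. 0::int) i)" by simp
    then show ?case by (rule exI[of _ "\<lambda>_. 0"])
  next
    case (incl h)
    then obtain i where i: "i < n" "h = q i" using S by auto
    then have "h = q i [^] (1 :: int)" using q by (simp add: Pi_def)
    then have "h = (\<Otimes>k\<in>{..<n}. q k [^] (if k = i then 1 else 0 :: int))"
      by (simp only: single[OF i(1)])
    then show ?case by (intro exI[of _ "\<lambda>k. if k = i then 1 else 0"])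
  next
    case (inv h)
    then obtain i where i: "i < n" "h = q i" using S by auto
    then have "inv h = q i [^] (-1 :: int)" using q by (simp add: Pi_def int_pow_neg)
    then have "inv h = (\<Otimes>k\<in>{..<n}. q k [^] (if k = i then -1 else 0 :: int))"
      by (simp only: single[OF i(1)])
    then show ?case by (intro exI[of _ "\<lambda>k. if k = i then -1 else 0"])
  next
    case (eng h1 h2)
    then obtain f g :: "nat \<Rightarrow> int" where
      "h1 = (\<Otimes>i\<in>{..<n}. q i [^] f i)" "h2 = (\<Otimes>i\<in>{..<n}. q i [^] g i)" by blast
    then have "h1 \<otimes> h2 = (\<Otimes>i\<in>{..<n}. q i [^] (f i + g i))"
      by (simp add: finprod_pow_mult[OF q])
    then show ?case by (intro exI[of _ "\<lambda>i. f i + g i"])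
  qed
  then have "spans {..<n} q" using q assms(3) by (auto simp: spans_def)
  then show ?thesis by blast
qed

text \<open>A spanning family of least size satisfies no nontrivial relation, by
  \<open>spans_reduce\<close>, and so is a basis. Given two basis elements, neither of them nor
  their product is a square, contrary to \<open>sq\<close>; hence the rank is at most 1.\<close>

lemma cyclic_if_squares_index_le_2:
  assumes tf: "\<forall>x\<in>carrier G. \<forall>n>0::nat. x [^] n = \<one> \<longrightarrow> x = \<one>"
    and fg: "finite S" "S \<subseteq> carrier G" "generate G S = carrier G"
    and sq: "\<And>x y. \<lbrakk>x \<in> carrier G; y \<in> carrier G\<rbrakk> \<Longrightarrow>
      \<exists>z\<in>carrier G. x = z \<otimes> z \<or> y = z \<otimes> z \<or> x \<otimes> y = z \<otimes> z"
  shows "\<exists>g\<in>carrier G. \<forall>x\<in>carrier G. \<exists>k::int. x = g [^] k"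
proof -
  have "\<exists>n I q. spans I q \<and> card I = n" using spans_of_finite_generate[OF fg] by blast
  then have "\<exists>n. (\<exists>I q. spans I q \<and> card I = n) \<and> (\<forall>m<n. \<not> (\<exists>I q. spans I q \<and> card I = m))"
    by (rule exists_least_iff[THEN iffD1])
  then obtain I q where sp: "spans I q" and min: "\<And>J p. spans J p \<Longrightarrow> \<not> card J < card I"
    by blast
  have I: "finite I" and q: "q \<in> I \<rightarrow> carrier G"
    and gen: "\<And>x. x \<in> carrier G \<Longrightarrow> \<exists>f :: nat \<Rightarrow> int. x = (\<Otimes>i\<in>I. q i [^] f i)"
    using sp by (auto simp: spans_def)
  have indep: "f i = 0" if "(\<Otimes>i\<in>I. q i [^] f i) = \<one>" "i \<in> I" for f :: "nat \<Rightarrow> int" and i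
    using spans_reduce[OF tf sp that] min by blast
  have indep2: "f i = g i" if "(\<Otimes>i\<in>I. q i [^] f i) = (\<Otimes>i\<in>I. q i [^] g i)" "i \<in> I"
    for f g :: "nat \<Rightarrow> int" and i
  proof -
    have "(\<Otimes>i\<in>I. q i [^] (f i + - g i)) = (\<Otimes>i\<in>I. q i [^] g i) \<otimes> (\<Otimes>i\<in>I. q i [^] (- g i))"
      by (simp only: finprod_pow_mult[OF q, symmetric] that(1))
    also have "\<dots> = \<one>"
      by (simp add: finprod_pow_mult[OF q])
    finally show ?thesis using indep[of "\<lambda>i. f i + - g i"] that(2) by simp
  qed
  have "card I \<le> 1"
  proof (rule ccontr)
    assume "\<not> card I \<le> 1"
    then obtain i j where ij: "i \<in> I" "j \<in> I" "i \<noteq> j"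
      by (metis One_nat_def card_le_Suc0_iff_eq[OF I])
    have single: "q l = (\<Otimes>k\<in>I. q k [^] (if k = l then 1 else 0 :: int))" if "l \<in> I" for l
    proof -
      have "(\<Otimes>k\<in>I - {l}. q k [^] (if k = l then 1 else 0 :: int)) = (\<Otimes>k\<in>I - {l}. \<one>)"
        by (rule finprod_cong) (auto simp: simp_implies_def)
      then show ?thesis
        using that q I by (subst finprod_pow_remove[of _ _ l]) (auto simp: Pi_def)
    qed
    obtain z where z: "z \<in> carrier G" "q i = z \<otimes> z \<or> q j = z \<otimes> z \<or> q i \<otimes> q j = z \<otimes> z"
      using sq[of "q i" "q j"] ij q by auto
    obtain f :: "nat \<Rightarrow> int" where f: "z = (\<Otimes>i\<in>I. q i [^] f i)" using gen[OF z(1)] by blast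
    have zz: "z \<otimes> z = (\<Otimes>i\<in>I. q i [^] (f i + f i))" by (simp add: f finprod_pow_mult[OF q])
    \<comment> \<open>The doubled exponents of \<open>z\<close> are compared with those of the
      element it squares to, at a position where the latter exponent is 1.\<close>
    have "\<exists>k. f k + f k = 1"
      using z(2)
    proof (elim disjE)
      assume "q i = z \<otimes> z"
      then show ?thesis using indep2[OF trans[OF zz[symmetric] trans[OF _ single[OF ij(1)]]] ij(1)] by auto
    next
      assume "q j = z \<otimes> z"
      then show ?thesis using indep2[OF trans[OF zz[symmetric] trans[OF _ single[OF ij(2)]]] ij(2)] by auto
    next
      assume "q i \<otimes> q j = z \<otimes> z"
      moreover have "q i \<otimes> q j = (\<Otimes>k\<in>I. q k [^] ((if k = i then 1 else 0) + (if k = j then 1 else 0 :: int)))"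
        using finprod_pow_mult[OF q, of "\<lambda>k. if k = i then 1 else 0" "\<lambda>k. if k = j then 1 else 0"]
          single[OF ij(1)] single[OF ij(2)] by simp
      ultimately show ?thesis
        using indep2[OF trans[OF zz[symmetric]], of "\<lambda>k. (if k = i then 1 else 0) + (if k = j then 1 else 0)" i] ij by auto
    qed
    then obtain k where "f k + f k = 1" by blast
    then have "even (1::int)" by (metis even_add)
    then show False by simp
  qed
  then consider "I = {}" | i where "I = {i}"
    using I by (metis One_nat_def card_1_singletonE card_0_eq le_Suc_eq le_zero_eq)
  then show ?thesis
  proof cases
    case 1
    then have "\<forall>x\<in>carrier G. \<exists>k::int. x = \<one> [^] k" using gen by (metis finprod_empty int_pow_0)
    then show ?thesis by blast
  next
    case 2
    then have "q i \<in> carrier G" using q by auto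
    moreover have "\<exists>k::int. x = q i [^] k" if "x \<in> carrier G" for x
      using gen[OF that] 2 \<open>q i \<in> carrier G\<close> by auto
    ultimately show ?thesis by blast
  qed
qed

end

section \<open>Extensions of the infinite dihedral group\<close>

context group
begin

lemma inv_cancel_left [simp]: "\<lbrakk>x \<in> carrier G; z \<in> carrier G\<rbrakk> \<Longrightarrow> inv x \<otimes> (x \<otimes> z) = z"
  by (simp add: m_assoc[symmetric])

lemma cancel_inv_left [simp]: "\<lbrakk>x \<in> carrier G; z \<in> carrier G\<rbrakk> \<Longrightarrow> x \<otimes> (inv x \<otimes> z) = z"
  by (simp add: m_assoc[symmetric])

lemma conj_int_pow:
  assumes "g \<in> carrier G" "x \<in> carrier G"
  shows "(g \<otimes> x \<otimes> inv g) [^] (k::int) = g \<otimes> x [^] k \<otimes> inv g"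
proof -
  have "(\<lambda>x. g \<otimes> x \<otimes> inv g) \<in> hom G G"
    using assms by (auto simp: hom_def m_assoc)
  then show ?thesis
    using hom_int_pow[of "\<lambda>x. g \<otimes> x \<otimes> inv g" G G x k] assms is_group by simp
qed

text \<open>Commuting with \<open>y\<close> means being fixed under conjugation by \<open>y\<close>,
  and conjugation respects powers.\<close>

lemma int_pow_commute:
  assumes "x \<in> carrier G" "y \<in> carrier G" "x \<otimes> y = y \<otimes> x"
  shows "x [^] (k::int) \<otimes> y = y \<otimes> x [^] k"
proof -
  have "y \<otimes> x \<otimes> inv y = x" using assms by (simp add: inv_solve_right')
  then have "x [^] k = y \<otimes> x [^] k \<otimes> inv y" using conj_int_pow[of y x k] assms by simp
  then show ?thesis using assms by (simp add: inv_solve_right)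
qed

lemma inv_commute:
  assumes "x \<in> carrier G" "y \<in> carrier G" "x \<otimes> y = y \<otimes> x"
  shows "inv x \<otimes> y = y \<otimes> inv x"
  using int_pow_commute[OF assms, of "-1"] assms by (simp add: int_pow_neg)

lemma int_pow_nat_pow:
  assumes "x \<in> carrier G"
  shows "(x [^] (k::int)) [^] (n::nat) = x [^] (k * int n)"
  using int_pow_pow[OF assms, of k "int n"] by (simp only: int_pow_int)

lemma subgroup_pow_card:
  assumes "subgroup K G" "x \<in> K"
  shows "x [^] card K = \<one>"
proof -
  have "x [^]\<^bsub>G\<lparr>carrier := K\<rparr>\<^esub> order (G\<lparr>carrier := K\<rparr>) = \<one>"
    using group.pow_order_eq_1[OF subgroup_imp_group[OF assms(1)], of x] assms(2) by simp
  then show ?thesis by (simp add: nat_pow_consistent[symmetric] order_def)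
qed

end

text \<open>The parameters \<open>\<zeta>\<close> and \<open>\<alpha>\<close> stand for \<open>a\<^sup>2 b\<^sup>2\<close> and \<open>a\<^sup>2\<close>, where \<open>t = a b\<close>.\<close>
locale dihedral_relations = group G for G (structure) +
  fixes C :: "'a set" and t a \<zeta> \<alpha> :: 'a
  assumes C_subgroup: "subgroup C G" and C_finite: "finite C"
    and t_closed [simp, intro]: "t \<in> carrier G" and a_closed [simp, intro]: "a \<in> carrier G"
    and \<zeta>_mem: "\<zeta> \<in> C" and \<alpha>_mem: "\<alpha> \<in> C"
    and t_C: "c \<in> C \<Longrightarrow> t \<otimes> c = c \<otimes> t" and a_C: "c \<in> C \<Longrightarrow> a \<otimes> c = c \<otimes> a"
    and a_t: "a \<otimes> t = \<zeta> \<otimes> inv t \<otimes> a" and a_a: "a \<otimes> a = \<alpha>"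
begin

text \<open>\<open>e\<close> is the exponent of \<open>a\<close>, boolean because
  \<open>a\<inverse>\<close> and \<open>a a\<close> can be absorbed into \<open>C\<close>.
  Uniqueness of these forms is available only in \<open>dihedral_extension\<close>.\<close>

definition nf :: "'a \<Rightarrow> int \<Rightarrow> bool \<Rightarrow> 'a" where
  "nf c k e = c \<otimes> t [^] k \<otimes> (if e then a else \<one>)"

lemma C_closed [simp]: "c \<in> C \<Longrightarrow> c \<in> carrier G"
  using C_subgroup subgroup.mem_carrier by metis

lemma C_mult [simp]: "\<lbrakk>c \<in> C; d \<in> C\<rbrakk> \<Longrightarrow> c \<otimes> d \<in> C"
  using C_subgroup by (rule subgroup.m_closed)

lemma C_inv [simp]: "c \<in> C \<Longrightarrow> inv c \<in> C"
  using C_subgroup by (rule subgroup.m_inv_closed)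

lemma C_one [simp]: "\<one> \<in> C"
  using C_subgroup by (rule subgroup.one_closed)

lemma C_int_pow [simp]: "c \<in> C \<Longrightarrow> c [^] (k::int) \<in> C"
  by (rule subgroup_int_pow_closed[OF C_subgroup])

lemma C_pow_card: "c \<in> C \<Longrightarrow> c [^] card C = \<one>"
  by (rule subgroup_pow_card[OF C_subgroup])

lemma card_C_pos: "card C > 0"
  using C_finite C_one by (metis card_gt_0_iff empty_iff)

lemma \<zeta>_closed [simp]: "\<zeta> \<in> carrier G" and \<alpha>_closed [simp]: "\<alpha> \<in> carrier G"
  using \<zeta>_mem \<alpha>_mem by auto

lemma nf_closed [simp]: "c \<in> C \<Longrightarrow> nf c k e \<in> carrier G"
  by (simp add: nf_def)

lemma t_pow_C: "c \<in> C \<Longrightarrow> t [^] (k::int) \<otimes> c = c \<otimes> t [^] k"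
  by (rule int_pow_commute) (auto simp: t_C)

lemma \<zeta>_eq: "\<zeta> = a \<otimes> t \<otimes> inv a \<otimes> t"
  by (simp add: a_t m_assoc)

text \<open>By \<open>\<zeta>_eq\<close>, \<open>\<zeta>\<close> is a word in \<open>a\<close> and
  \<open>t\<close>, both of which centralize \<open>C\<close>. As it also lies in \<open>C\<close>,
  it belongs to the center of \<open>C\<close>.\<close>

lemma \<zeta>_C:
  assumes "c \<in> C"
  shows "\<zeta> \<otimes> c = c \<otimes> \<zeta>"
proof -
  have ia: "inv a \<otimes> c = c \<otimes> inv a"
    by (rule inv_commute) (use a_C[OF assms] assms in auto)
  have "\<zeta> \<otimes> c = a \<otimes> (t \<otimes> (inv a \<otimes> (t \<otimes> c)))"
    using assms by (simp add: \<zeta>_eq m_assoc)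
  also have "\<dots> = a \<otimes> (t \<otimes> (inv a \<otimes> c \<otimes> t))"
    using assms by (simp add: t_C m_assoc)
  also have "\<dots> = a \<otimes> (t \<otimes> c \<otimes> (inv a \<otimes> t))"
    using assms by (simp add: ia m_assoc)
  also have "\<dots> = a \<otimes> c \<otimes> (t \<otimes> (inv a \<otimes> t))"
    using assms by (simp add: t_C m_assoc)
  also have "\<dots> = c \<otimes> \<zeta>"
    using assms by (simp add: a_C \<zeta>_eq m_assoc)
  finally show ?thesis .
qed

text \<open>Conjugation by \<open>a\<close> sends \<open>t\<close> to
  \<open>\<zeta> t\<inverse>\<close>. The two factors commute, so its powers split.\<close>

lemma a_t_pow: "a \<otimes> t [^] (k::int) = \<zeta> [^] k \<otimes> t [^] (- k) \<otimes> a"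
proof -
  have "a \<otimes> t \<otimes> inv a = \<zeta> \<otimes> inv t"
    by (simp add: a_t m_assoc)
  then have "a \<otimes> t [^] k \<otimes> inv a = (\<zeta> \<otimes> inv t) [^] k"
    using conj_int_pow[of a t k] by simp
  also have "\<dots> = \<zeta> [^] k \<otimes> inv t [^] k"
  proof (rule int_pow_mult_distrib)
    show "\<zeta> \<otimes> inv t = inv t \<otimes> \<zeta>"
      using t_pow_C[OF \<zeta>_mem, of "-1"] by (simp add: int_pow_neg)
  qed auto
  also have "\<dots> = \<zeta> [^] k \<otimes> t [^] (- k)"
    by (simp add: int_pow_inv int_pow_neg)
  finally show ?thesis by (simp add: inv_solve_right')
qed

lemma nf_mult_False:
  assumes "c \<in> C" "d \<in> C"
  shows "nf c k False \<otimes> nf d l e = nf (c \<otimes> d) (k + l) e"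
proof -
  let ?a = "if e then a else \<one>"
  have "nf c k False \<otimes> nf d l e = c \<otimes> (t [^] k \<otimes> d) \<otimes> t [^] l \<otimes> ?a"
    using assms by (simp add: nf_def m_assoc)
  also have "\<dots> = (c \<otimes> d) \<otimes> (t [^] k \<otimes> t [^] l) \<otimes> ?a"
    unfolding t_pow_C[OF assms(2)] using assms by (simp add: m_assoc)
  finally show ?thesis by (simp add: nf_def int_pow_mult)
qed

text \<open>Moving \<open>a\<close> to the right past \<open>d\<close> changes nothing, past
  \<open>t^l\<close> it inverts that power at the cost of \<open>\<zeta>^l\<close>, and
  \<open>a a\<close> is \<open>\<alpha>\<close>. With \<open>nf_mult_False\<close> this gives a
  multiplication table depending only on \<open>C\<close>, \<open>\<zeta>\<close> and
  \<open>\<alpha>\<close>.\<close>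

lemma nf_mult_True:
  assumes "c \<in> C" "d \<in> C"
  shows "nf c k True \<otimes> nf d l e = nf (c \<otimes> d \<otimes> \<zeta> [^] l \<otimes> (if e then \<alpha> else \<one>)) (k - l) (\<not> e)"
proof -
  let ?a = "if e then a else \<one>"
  let ?z = "\<zeta> [^] l" let ?A = "if e then \<alpha> else \<one>"
  have z: "?z \<in> C" by (simp add: \<zeta>_mem)
  have A: "?A \<in> C" by (simp add: \<alpha>_mem)
  have "nf c k True \<otimes> nf d l e = c \<otimes> t [^] k \<otimes> (a \<otimes> d) \<otimes> t [^] l \<otimes> ?a"
    using assms by (simp add: nf_def m_assoc)
  also have "\<dots> = c \<otimes> (t [^] k \<otimes> d) \<otimes> (a \<otimes> t [^] l) \<otimes> ?a"
    unfolding a_C[OF assms(2)] using assms by (simp add: m_assoc)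
  also have "\<dots> = (c \<otimes> d) \<otimes> (t [^] k \<otimes> ?z) \<otimes> (t [^] (- l) \<otimes> (a \<otimes> ?a))"
    unfolding t_pow_C[OF assms(2)] a_t_pow using assms by (simp add: m_assoc)
  also have "a \<otimes> ?a = ?A \<otimes> (if \<not> e then a else \<one>)" by (simp add: a_a)
  also have "(c \<otimes> d) \<otimes> (t [^] k \<otimes> ?z) \<otimes> (t [^] (- l) \<otimes> (?A \<otimes> (if \<not> e then a else \<one>)))
      = (c \<otimes> d \<otimes> ?z) \<otimes> (t [^] k \<otimes> (t [^] (- l) \<otimes> ?A)) \<otimes> (if \<not> e then a else \<one>)"
    unfolding t_pow_C[OF z] using assms by (simp add: m_assoc)
  also have "t [^] k \<otimes> (t [^] (- l) \<otimes> ?A) = ?A \<otimes> (t [^] k \<otimes> t [^] (- l))"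
    using t_pow_C[OF A, of "k - l"] by (simp add: int_pow_mult[symmetric] m_assoc[symmetric])
  also have "t [^] k \<otimes> t [^] (- l) = t [^] (k - l)"
    by (simp add: int_pow_mult[symmetric])
  finally show ?thesis
    using assms A by (simp add: nf_def m_assoc)
qed

end

text \<open>The two assumptions give uniqueness and existence of normal forms; the multiplication
  table then determines the group up to isomorphism.\<close>

locale dihedral_extension = dihedral_relations +
  assumes t_pow_mem: "t [^] (k::int) \<in> C \<Longrightarrow> k = 0"
    and ex_nf: "x \<in> carrier G \<Longrightarrow> \<exists>c\<in>C. \<exists>k e. x = nf c k e"
begin

lemma nf_False_inject:
  assumes "c \<in> C" "d \<in> C" "c \<otimes> t [^] (k::int) = d \<otimes> t [^] l"
  shows "c = d \<and> k = l"
proof -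
  have "t [^] k = inv c \<otimes> (d \<otimes> t [^] l)"
    using assms by (simp add: inv_solve_left)
  then have "t [^] (k - l) = inv c \<otimes> d"
    using assms by (simp add: int_pow_diff m_assoc)
  then have "t [^] (k - l) \<in> C" using assms by simp
  then have "k = l" using t_pow_mem by fastforce
  then show ?thesis using assms by simp
qed

text \<open>Every \<open>c t^k\<close> commutes with \<open>t\<close>. If \<open>a\<close> did, the
  relation \<open>a_t\<close> would force \<open>t^2 = \<zeta>\<close>, putting a nontrivial power
  of \<open>t\<close> into \<open>C\<close>.\<close>

lemma a_not_nf_False:
  assumes "c \<in> C"
  shows "a \<noteq> c \<otimes> t [^] (k::int)"
proof
  assume a: "a = c \<otimes> t [^] k"
  have "a \<otimes> t = c \<otimes> (t [^] k \<otimes> t)" unfolding a using assms by (simp add: m_assoc)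
  also have "t [^] k \<otimes> t = t \<otimes> t [^] k" by (rule int_pow_commute) auto
  also have "c \<otimes> (t \<otimes> t [^] k) = (t \<otimes> c) \<otimes> t [^] k" using assms by (simp add: t_C m_assoc)
  also have "\<dots> = t \<otimes> a" unfolding a using assms by (simp add: m_assoc)
  finally have "\<zeta> \<otimes> inv t = t" using a_t by simp
  then have "\<zeta> = t \<otimes> t" by (simp add: inv_solve_right')
  also have "\<dots> = t [^] (2::int)" using int_pow_mult[of t 1 1] by simp
  finally have "t [^] (2::int) \<in> C" using \<zeta>_mem by simp
  then show False using t_pow_mem by fastforce
qed

lemma nf_inject:
  assumes "c \<in> C" "d \<in> C"
  shows "nf c k e = nf d l f \<longleftrightarrow> c = d \<and> k = l \<and> e = f"
proof
  have *: False if "c \<in> C" "d \<in> C" "nf c k True = nf d l False" for c d k l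
  proof -
    have "a = inv (c \<otimes> t [^] k) \<otimes> (d \<otimes> t [^] l)"
      using that by (simp add: nf_def inv_solve_left)
    also have "\<dots> = t [^] (- k) \<otimes> (inv c \<otimes> d) \<otimes> t [^] l"
      using that by (simp add: inv_mult_group int_pow_neg m_assoc)
    also have "\<dots> = inv c \<otimes> d \<otimes> t [^] (l - k)"
      using that t_pow_C[of "inv c \<otimes> d" "-k"] by (simp add: m_assoc int_pow_mult[symmetric])
    finally show False using a_not_nf_False[of "inv c \<otimes> d" "l - k"] that by simp
  qed
  assume eq: "nf c k e = nf d l f"
  then have "e = f" using *[OF assms, of k l] *[OF assms(2,1), of l k] by (cases e; cases f) auto
  moreover have "c \<otimes> t [^] k = d \<otimes> t [^] l"
    using eq assms \<open>e = f\<close> by (auto simp: nf_def split: if_splits)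
  ultimately show "c = d \<and> k = l \<and> e = f" using nf_False_inject[OF assms] by blast
qed simp

lemma bij_betw_nf: "bij_betw (\<lambda>(c, k, e). nf c k e) (C \<times> UNIV) (carrier G)"
  unfolding bij_betw_def
proof
  show "inj_on (\<lambda>(c, k, e). nf c k e) (C \<times> UNIV)"
    by (auto simp: inj_on_def nf_inject)
  show "(\<lambda>(c, k, e). nf c k e) ` (C \<times> UNIV) = carrier G"
    using ex_nf by (force simp: image_iff)
qed

end

text \<open>The isomorphism sends the normal form with data \<open>(c, k, e)\<close> to the one with
  data \<open>(\<phi> c, k, e)\<close>. It is bijective because normal forms are unique and
  exhaustive on both sides, and multiplicative because the multiplication table involves only data
  that \<open>\<phi>\<close> respects.\<close>

lemma dihedral_extension_iso:
  assumes G: "dihedral_extension G C t a \<zeta> \<alpha>" and H: "dihedral_extension H D s b \<eta> \<beta>"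
    and \<phi>: "\<phi> \<in> hom (G\<lparr>carrier := C\<rparr>) H" "bij_betw \<phi> C D" "\<phi> \<zeta> = \<eta>" "\<phi> \<alpha> = \<beta>"
  shows "G \<cong> H"
proof -
  interpret G: dihedral_extension G C t a \<zeta> \<alpha> by fact
  interpret H: dihedral_extension H D s b \<eta> \<beta> by fact
  have mem: "\<phi> c \<in> D" if "c \<in> C" for c using \<phi>(2) that by (auto simp: bij_betw_def)
  have mult: "\<phi> (c \<otimes>\<^bsub>G\<^esub> d) = \<phi> c \<otimes>\<^bsub>H\<^esub> \<phi> d" if "c \<in> C" "d \<in> C" for c d
    using \<phi>(1) that by (auto simp: hom_def)
  have pow: "\<phi> (\<zeta> [^]\<^bsub>G\<^esub> k) = \<eta> [^]\<^bsub>H\<^esub> k" for k :: int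
  proof -
    have "\<phi> (\<zeta> [^]\<^bsub>G\<lparr>carrier := C\<rparr>\<^esub> k) = \<phi> \<zeta> [^]\<^bsub>H\<^esub> k"
      by (rule hom_int_pow[OF \<phi>(1)]) (use G.\<zeta>_mem G.subgroup_imp_group[OF G.C_subgroup] H.is_group in auto)
    then show ?thesis
      using G.int_pow_consistent[OF G.C_subgroup G.\<zeta>_mem] \<phi>(3) by simp
  qed
  have one: "\<phi> \<one>\<^bsub>G\<^esub> = \<one>\<^bsub>H\<^esub>" using pow[of 0] by simp
  define n where "n = (\<lambda>(c, k, e). G.nf c k e)"
  define m where "m = (\<lambda>(c, k, e). H.nf (\<phi> c) k e)"
  have n: "bij_betw n (C \<times> UNIV) (carrier G)" unfolding n_def by (rule G.bij_betw_nf)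
  have "bij_betw (map_prod \<phi> id) (C \<times> UNIV) (D \<times> UNIV)"
    by (rule bij_betw_map_prod[OF \<phi>(2) bij_id])
  then have "bij_betw ((\<lambda>(c, k, e). H.nf c k e) \<circ> map_prod \<phi> id) (C \<times> UNIV) (carrier H)"
    using H.bij_betw_nf by (rule bij_betw_trans)
  moreover have "(\<lambda>(c, k, e). H.nf c k e) \<circ> map_prod \<phi> id = m"
    by (auto simp: m_def fun_eq_iff)
  ultimately have m: "bij_betw m (C \<times> UNIV) (carrier H)" by simp
  define h where "h = m \<circ> inv_into (C \<times> UNIV) n"
  have h_bij: "bij_betw h (carrier G) (carrier H)"
    unfolding h_def by (rule bij_betw_trans[OF bij_betw_inv_into[OF n] m])
  have h_nf: "h (G.nf c k e) = H.nf (\<phi> c) k e" if "c \<in> C" for c k e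
    using inv_into_f_f[OF bij_betw_imp_inj_on[OF n], of "(c, k, e)"] that
    by (simp add: h_def n_def m_def)
  have "h (x \<otimes>\<^bsub>G\<^esub> y) = h x \<otimes>\<^bsub>H\<^esub> h y" if xy: "x \<in> carrier G" "y \<in> carrier G" for x y
  proof -
    obtain c k e where x: "c \<in> C" "x = G.nf c k e" using G.ex_nf xy(1) by blast
    obtain d l f where y: "d \<in> C" "y = G.nf d l f" using G.ex_nf xy(2) by blast
    show ?thesis
    proof (cases e)
      case False
      then show ?thesis using x y
        by (simp add: G.nf_mult_False H.nf_mult_False h_nf mem mult)
    next
      case True
      have "(if f then \<alpha> else \<one>\<^bsub>G\<^esub>) \<in> C" "\<zeta> [^]\<^bsub>G\<^esub> l \<in> C"
        by (auto simp: G.\<alpha>_mem G.\<zeta>_mem)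
      then show ?thesis using x y True
        by (simp add: G.nf_mult_True H.nf_mult_True h_nf mem mult pow one \<phi>(4)
            G.\<alpha>_mem if_distrib[of \<phi>])
    qed
  qed
  moreover have "h x \<in> carrier H" if "x \<in> carrier G" for x
    using h_bij that by (auto simp: bij_betw_def)
  ultimately have "h \<in> iso G H" using h_bij by (auto simp: iso_def hom_def)
  then show ?thesis by (rule is_isoI)
qed

lemma (in dihedral_relations) nf_mod:
  assumes "t [^] (m::int) \<in> C" "c \<in> C"
  shows "nf c j e = nf (c \<otimes> (t [^] m) [^] (j div m)) (j mod m) e"
proof -
  have "t [^] j = t [^] (m * (j div m) + j mod m)" by simp
  also have "\<dots> = (t [^] m) [^] (j div m) \<otimes> t [^] (j mod m)"
    by (simp only: int_pow_mult int_pow_pow t_closed)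
  finally have j: "t [^] j = (t [^] m) [^] (j div m) \<otimes> t [^] (j mod m)" .
  show ?thesis unfolding nf_def j using assms by (simp add: m_assoc)
qed

text \<open>A power of \<open>t\<close> inside \<open>C\<close> can be absorbed into the
  \<open>C\<close>-part, which bounds the exponents in normal forms. Applied in contrapositive form,
  this makes \<open>t\<close> of infinite order modulo \<open>C\<close> in an infinite
  group.\<close>

lemma (in dihedral_relations) finite_if_t_pow_mem:
  assumes "t [^] (k::int) \<in> C" "k \<noteq> 0" and nf: "\<And>x. x \<in> carrier G \<Longrightarrow> \<exists>c\<in>C. \<exists>k e. x = nf c k e"
  shows "finite (carrier G)"
proof -
  define m where "m = \<bar>k\<bar>"
  have m: "m > 0" "t [^] m \<in> C"
    using assms(1,2) C_inv[OF assms(1)] by (auto simp: m_def abs_if int_pow_neg)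
  have "carrier G \<subseteq> (\<lambda>(c, j, e). nf c j e) ` (C \<times> {0..<m} \<times> UNIV)"
  proof
    fix x assume "x \<in> carrier G"
    then obtain c j e where x: "c \<in> C" "x = nf c j e" using nf by blast
    then have "x = (\<lambda>(c, j, e). nf c j e) (c \<otimes> (t [^] m) [^] (j div m), j mod m, e)"
      using nf_mod[OF m(2)] by simp
    moreover have "(c \<otimes> (t [^] m) [^] (j div m), j mod m, e) \<in> C \<times> {0..<m} \<times> UNIV"
      using x m by simp
    ultimately show "x \<in> (\<lambda>(c, j, e). nf c j e) ` (C \<times> {0..<m} \<times> UNIV)" by blast
  qed
  moreover have "finite ((\<lambda>(c, j, e). nf c j e) ` (C \<times> {0..<m} \<times> (UNIV::bool set)))"
    using C_finite by auto
  ultimately show ?thesis by (rule finite_subset)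
qed

section \<open>The amalgam as a dihedral extension\<close>

text \<open>Neither \<open>x\<close> nor \<open>inv y\<close> lies in \<open>C\<close>, so with only
  two cosets available both lie in the same one; their quotient is
  \<open>x \<otimes> y\<close>.\<close>

lemma (in group) index_two_mult_mem:
  assumes C: "subgroup C G" and two: "card (rcosets C) = 2"
    and x: "x \<in> carrier G" "x \<notin> C" and y: "y \<in> carrier G" "y \<notin> C"
  shows "x \<otimes> y \<in> C"
proof -
  have sub: "C \<subseteq> carrier G" using C by (rule subgroup.subset)
  have mem: "C \<in> rcosets C" "C #> x \<in> rcosets C" "C #> inv y \<in> rcosets C"
    using x y sub subgroup.subgroup_in_rcosets[OF C is_group] by (auto intro: rcosetsI)
  have self: "x \<in> C #> x" "inv y \<in> C #> inv y"
    using rcos_self[OF _ C] x y by auto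
  have "inv y \<notin> C" using y subgroup.m_inv_closed[OF C, of "inv y"] by auto
  with self x have "C #> x \<noteq> C" "C #> inv y \<noteq> C" by auto
  moreover obtain P Q where "rcosets C = {P, Q}" using two by (auto simp: card_2_iff)
  ultimately have "C #> x = C #> inv y" using mem by auto
  then obtain h where h: "h \<in> C" "x = h \<otimes> inv y" using self(1) by (auto simp: r_coset_def)
  then have "x \<otimes> y = h" using y sub by (auto simp: m_assoc)
  then show ?thesis using h by simp
qed

text \<open>The universal property in \<open>amalgam\<close> speaks of target groups on
  \<open>nat\<close>; this copy makes \<open>G\<close> itself an admissible target.\<close>

lemma countable_group_iso_nat:
  fixes G (structure)
  assumes "group G" "countable (carrier G)"
  shows "\<exists>(K :: nat monoid) h. group K \<and> h \<in> iso G K"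
proof -
  interpret group G by fact
  define h where "h = to_nat_on (carrier G)"
  have inj: "inj_on h (carrier G)" unfolding h_def by (rule inj_on_to_nat_on[OF assms(2)])
  define g where "g = inv_into (carrier G) h"
  have g: "g (h x) = x" if "x \<in> carrier G" for x
    using inv_into_f_f[OF inj that] by (simp add: g_def)
  define K :: "nat monoid" where
    "K = \<lparr>carrier = h ` carrier G, mult = \<lambda>x y. h (g x \<otimes> g y), one = h \<one>\<rparr>"
  have "group K"
  proof (rule groupI)
    fix x assume "x \<in> carrier K"
    then obtain u where u: "u \<in> carrier G" "x = h u" by (auto simp: K_def)
    then show "\<exists>y\<in>carrier K. y \<otimes>\<^bsub>K\<^esub> x = \<one>\<^bsub>K\<^esub>"
      by (intro bexI[of _ "h (inv u)"]) (auto simp: K_def g)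
  qed (auto simp: K_def g m_assoc)
  moreover have "h \<in> iso G K"
    using inj by (auto simp: iso_def hom_def K_def g bij_betw_def)
  ultimately show ?thesis by blast
qed

text \<open>The universal property extends the inclusions of \<open>A\<close> and \<open>B\<close> to a retraction of \<open>G\<close>
  onto the subgroup they generate; by uniqueness it is the identity.\<close>
lemma amalgam_generate:
  assumes "group G" "countable (carrier G)" and am: "amalgam G A B C"
  shows "generate G (A \<union> B) = carrier G"
proof -
  interpret group G by fact
  obtain K :: "nat monoid" and h where K: "group K" "h \<in> iso G K"
    using countable_group_iso_nat[OF assms(1,2)] by blast
  interpret K: group K by fact
  interpret h: group_hom G K h
    by unfold_locales (use K in \<open>auto simp: iso_def\<close>)
  have AB: "subgroup A G" "subgroup B G" "C = A \<inter> B" using am by (auto simp: amalgam_def)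
  have sub: "A \<subseteq> carrier G" "B \<subseteq> carrier G" using AB subgroup.subset by auto
  define L where "L = generate G (A \<union> B)"
  have L: "subgroup L G" unfolding L_def using sub by (intro generate_is_subgroup) auto
  have incl: "A \<subseteq> L" "B \<subseteq> L" unfolding L_def by (auto intro: generate.incl)
  \<comment> \<open>The copy of \<open>L\<close> inside \<open>K\<close>, used as a target of the
    universal property in its own right.\<close>
  define M where "M = K\<lparr>carrier := h ` L\<rparr>"
  have "subgroup (h ` L) K" by (rule h.subgroup_img_is_subgroup[OF L])
  then have M: "group M" unfolding M_def by (rule K.subgroup_imp_group)
  have homM: "h \<in> hom (G\<lparr>carrier := A\<rparr>) M" "h \<in> hom (G\<lparr>carrier := B\<rparr>) M"
    using incl sub by (auto simp: hom_def M_def subset_iff)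
  have homK: "h \<in> hom (G\<lparr>carrier := A\<rparr>) K" "h \<in> hom (G\<lparr>carrier := B\<rparr>) K"
    using sub by (auto simp: hom_def subset_iff)
  obtain p where p: "p \<in> hom G M" "\<forall>a\<in>A. p a = h a" "\<forall>b\<in>B. p b = h b"
    using am M homM unfolding amalgam_def by blast
  have "p x \<in> carrier K" if "x \<in> carrier G" for x
    using p(1) that subgroup.subset[OF L] by (force simp: hom_def M_def)
  then have "p \<in> hom G K" using p(1) by (auto simp: hom_def M_def)
  moreover obtain r where "\<forall>h' \<in> hom G K. (\<forall>a\<in>A. h' a = h a) \<and> (\<forall>b\<in>B. h' b = h b) \<longrightarrow>
             (\<forall>x\<in>carrier G. h' x = r x)"
    using am K(1) homK unfolding amalgam_def by blast
  \<comment> \<open>As a map into \<open>K\<close>, \<open>p\<close> has the same restrictions to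
    \<open>A\<close> and \<open>B\<close> as \<open>h\<close>, so the two coincide. Hence
    \<open>h\<close> takes all its values in the image of \<open>L\<close>, and injectivity gives
    \<open>L = carrier G\<close>.\<close>
  ultimately have ph: "p x = h x" if "x \<in> carrier G" for x
    using p(2,3) h.homh that by metis
  have "carrier G \<subseteq> L"
  proof
    fix x assume x: "x \<in> carrier G"
    then have "h x \<in> h ` L" using ph[OF x] hom_in_carrier[OF p(1) x] by (simp add: M_def)
    then obtain y where y: "y \<in> L" "h x = h y" by auto
    moreover have "y \<in> carrier G" using y L subgroup.subset by blast
    ultimately show "x \<in> L"
      using x K(2) by (auto simp: iso_iff dest: inj_onD)
  qed
  then show ?thesis using subgroup.subset[OF L] unfolding L_def by blast
qed

text \<open>Finitely many cosets of a cyclic, hence countable, subgroup cover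
  \<open>G\<close>.\<close>

lemma virtually_cyclic_countable:
  fixes G (structure)
  assumes "group G" "virtually_cyclic G"
  shows "countable (carrier G)"
proof -
  interpret group G by fact
  obtain H h where H: "subgroup H G" "finite (rcosets H)" "h \<in> H" "H = generate G {h}"
    using assms(2) by (auto simp: virtually_cyclic_def)
  have "h \<in> carrier G" using H subgroup.subset by blast
  then have "H = range (\<lambda>k::int. h [^] k)" using H(4) generate_pow by auto
  then have "countable H" by (metis countableI_type countable_image)
  then have "countable X" if "X \<in> rcosets H" for X
    using that by (auto simp: RCOSETS_def r_coset_def)
  then have "countable (\<Union>(rcosets H))"
    using H(2) countable_UN[of "rcosets H" "\<lambda>X. X"] by (simp add: countable_finite)
  then show ?thesis using rcosets_part_G[OF H(1)] by simp
qed

text \<open>Normality of a subgroup of index 2. If the conjugate by some \<open>x\<close> outside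
  \<open>C\<close> were outside \<open>C\<close>, its product with \<open>x\<close>, which is
  \<open>x \<otimes> c\<close>, would lie in \<open>C\<close>, and so would
  \<open>x\<close>.\<close>

lemma (in group) conj_mem_of_index_two:
  assumes A: "subgroup A G" and C: "subgroup C G" "C \<subseteq> A" and two: "sub_index G A C = 2"
    and "x \<in> A" "c \<in> C"
  shows "x \<otimes> c \<otimes> inv x \<in> C"
proof (cases "x \<in> C")
  case True
  then show ?thesis using C assms by (simp add: subgroup.m_closed subgroup.m_inv_closed)
next
  case False
  interpret A: group "G\<lparr>carrier := A\<rparr>" by (rule subgroup_imp_group[OF A])
  have C': "subgroup C (G\<lparr>carrier := A\<rparr>)" using subgroup_incl[OF C(1) A C(2)] .
  have car: "x \<in> carrier G" "c \<in> carrier G" using assms A subgroup.mem_carrier by auto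
  have mem: "x \<otimes> c \<in> A" "x \<otimes> c \<otimes> inv x \<in> A"
    using assms by (auto intro!: subgroup.m_closed[OF A] subgroup.m_inv_closed[OF A])
  show ?thesis
  proof (rule ccontr)
    assume "x \<otimes> c \<otimes> inv x \<notin> C"
    then have "x \<otimes> c \<otimes> inv x \<otimes> x \<in> C"
      using A.index_two_mult_mem[OF C', of "x \<otimes> c \<otimes> inv x" x] two mem False \<open>x \<in> A\<close>
      by (simp add: sub_index_def)
    then have "x \<otimes> c \<in> C" using car by (simp add: m_assoc)
    then have "x \<otimes> c \<otimes> inv c \<in> C" using C(1) assms by (simp add: subgroup.m_closed subgroup.m_inv_closed)
    then show False using False car by (simp add: m_assoc)
  qed
qed

text \<open>By normality \<open>g\<close> lies in the normalizer, so it acts on \<open>C\<close>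
  like some element of \<open>C\<close>. Multiplying \<open>g\<close> by the inverse of that element
  cancels the action.\<close>

lemma (in group) ex_centralizing_mod:
  assumes C: "C \<lhd> G" and inner: "conj_image G C = inner_auts G C" and g: "g \<in> carrier G"
  shows "\<exists>c\<in>C. \<forall>x\<in>C. (c \<otimes> g) \<otimes> x = x \<otimes> (c \<otimes> g)"
proof -
  have sub: "subgroup C G" using C by (rule normal_imp_subgroup)
  have car: "x \<in> carrier G" if "x \<in> C" for x using that sub subgroup.mem_carrier by metis
  have subC: "C \<subseteq> carrier G" using car by auto
  \<comment> \<open>\<open>normalizer\<close> is the stabilizer of \<open>C\<close> under
    conjugation of subsets, so membership of \<open>g\<close> amounts to an identity of
    cosets.\<close>
  have "g <# C #> inv g = C #> g #> inv g" using normal.coset_eq[OF C] g by auto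
  also have "\<dots> = C" using g subC by (simp add: coset_mult_assoc coset_mult_one)
  finally have "g \<in> normalizer G C"
    using g subC by (simp add: normalizer_def stabilizer_def)
  then have "(\<lambda>x\<in>C. g \<otimes> x \<otimes> inv g) \<in> inner_auts G C"
    using inner by (auto simp: conj_image_def)
  then obtain c where c: "c \<in> C" "(\<lambda>x\<in>C. g \<otimes> x \<otimes> inv g) = (\<lambda>x\<in>C. c \<otimes> x \<otimes> inv c)"
    by (auto simp: inner_auts_def)
  have "(inv c \<otimes> g) \<otimes> x = x \<otimes> (inv c \<otimes> g)" if x: "x \<in> C" for x
  proof -
    have "g \<otimes> x \<otimes> inv g = c \<otimes> x \<otimes> inv c"
      using fun_cong[OF c(2), of x] x by simp
    then have "inv c \<otimes> (g \<otimes> x \<otimes> inv g) \<otimes> g = inv c \<otimes> (c \<otimes> x \<otimes> inv c) \<otimes> g" by simp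
    then show ?thesis using g car[OF x] car[OF c(1)] by (simp add: m_assoc)
  qed
  then show ?thesis using subgroup.m_inv_closed[OF sub c(1)] by blast
qed

text \<open>Elements \<open>a\<close> and \<open>b\<close> centralizing \<open>C\<close> are chosen
  in the two factors outside \<open>C\<close>. The normal forms in \<open>t = a b\<close> include
  \<open>A\<close> and \<open>B\<close> and are closed under products, so they exhaust the group
  generated by the factors, which is \<open>G\<close>. Infinitude of \<open>G\<close> keeps
  nontrivial powers of \<open>t\<close> out of \<open>C\<close>.\<close>

lemma amalgam_dihedral_extension:
  fixes G (structure)
  assumes "group G" "infinite (carrier G)" "virtually_cyclic G"
    and am: "amalgam G A B C" and fin: "finite A"
    and two: "sub_index G A C = 2" "sub_index G B C = 2"
    and inner: "conj_image G C = inner_auts G C"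
  shows "C \<lhd> G \<and> (\<exists>t a \<zeta> \<alpha>. dihedral_extension G C t a \<zeta> \<alpha>)"
proof -
  interpret group G by fact
  have AB: "subgroup A G" "subgroup B G" and CAB: "C = A \<inter> B" using am by (auto simp: amalgam_def)
  have C: "subgroup C G" unfolding CAB by (rule subgroups_Inter_pair[OF AB])
  have gen: "generate G (A \<union> B) = carrier G"
    by (rule amalgam_generate[OF assms(1) virtually_cyclic_countable am]) fact+
  have CA: "C \<subseteq> A" "C \<subseteq> B" using CAB by auto
  have car: "x \<in> carrier G" if "x \<in> A \<or> x \<in> B" for x
    using that AB subgroup.mem_carrier by metis
  have invAB: "inv x \<in> A \<union> B" if "x \<in> A \<union> B" for x
    using that subgroup.m_inv_closed[OF AB(1)] subgroup.m_inv_closed[OF AB(2)] by auto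
  have conjAB: "x \<otimes> c \<otimes> inv x \<in> C" if "x \<in> A \<union> B" "c \<in> C" for x c
    using that conj_mem_of_index_two[OF AB(1) C CA(1) two(1)]
      conj_mem_of_index_two[OF AB(2) C CA(2) two(2)] by auto
  have conj: "\<forall>c\<in>C. x \<otimes> c \<otimes> inv x \<in> C" if "x \<in> generate G (A \<union> B)" for x
    using that
  proof induction
    case one
    then show ?case using car CA by auto
  next
    case (incl h)
    then show ?case using conjAB by blast
  next
    case (inv h)
    then have "inv h \<in> A \<union> B" by (rule invAB)
    then show ?case using conjAB by blast
  next
    case (eng g h)
    have gh: "g \<in> carrier G" "h \<in> carrier G" using eng gen by auto
    show ?case
    proof
      fix c assume c: "c \<in> C"
      then have "g \<otimes> (h \<otimes> c \<otimes> inv h) \<otimes> inv g \<in> C" using eng by blast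
      then show "g \<otimes> h \<otimes> c \<otimes> inv (g \<otimes> h) \<in> C"
        using gh c car CA by (auto simp: inv_mult_group m_assoc subset_iff)
    qed
  qed
  then have norm: "C \<lhd> G" using C gen by (simp add: normal_inv_iff)
  \<comment> \<open>Stated for a general \<open>X\<close> because it serves both factors. An element
    of \<open>X\<close> outside \<open>C\<close> is corrected by an element of \<open>C\<close> so
    as to centralize \<open>C\<close>; index 2 then gives the remaining claims.\<close>
  have twist: "\<exists>a\<in>X. a \<notin> C \<and> (\<forall>x\<in>C. a \<otimes> x = x \<otimes> a) \<and> (\<forall>x\<in>X. x \<in> C \<or> (\<exists>c\<in>C. x = c \<otimes> a)) \<and> a \<otimes> a \<in> C"
    if X: "subgroup X G" "C \<subseteq> X" "sub_index G X C = 2" for X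
  proof -
    interpret X: group "G\<lparr>carrier := X\<rparr>" by (rule subgroup_imp_group[OF X(1)])
    have C': "subgroup C (G\<lparr>carrier := X\<rparr>)" using subgroup_incl[OF C X(1,2)] .
    have mult: "x \<otimes> y \<in> C" if "x \<in> X" "y \<in> X" "x \<notin> C" "y \<notin> C" for x y
      using X.index_two_mult_mem[OF C', of x y] X(3) that by (simp add: sub_index_def)
    have "C \<noteq> X"
    proof
      assume "C = X"
      have "rcosets\<^bsub>G\<lparr>carrier := X\<rparr>\<^esub> X = {X}"
      proof -
        have "X #>\<^bsub>G\<lparr>carrier := X\<rparr>\<^esub> y = X" if "y \<in> X" for y
          using X.coset_join2[OF _ X.subgroup_self] that by simp
        moreover have "\<one> \<in> X" using X(1) by (rule subgroup.one_closed)
        ultimately show ?thesis by (auto simp: RCOSETS_def)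
      qed
      then show False using X(3) \<open>C = X\<close> by (simp add: sub_index_def)
    qed
    then obtain a0 where a0: "a0 \<in> X" "a0 \<notin> C" using X(2) by blast
    have carX: "x \<in> carrier G" if "x \<in> X" for x using that X(1) subgroup.mem_carrier by metis
    obtain c where c: "c \<in> C" "\<forall>x\<in>C. (c \<otimes> a0) \<otimes> x = x \<otimes> (c \<otimes> a0)"
      using ex_centralizing_mod[OF norm inner carX[OF a0(1)]] by blast
    define a where "a = c \<otimes> a0"
    have cX: "c \<in> X" using c X(2) by auto
    have aX: "a \<in> X" unfolding a_def by (rule subgroup.m_closed[OF X(1) cX a0(1)])
    have aC: "a \<notin> C"
    proof
      assume "a \<in> C"
      then have "inv c \<otimes> a \<in> C" using c C by (simp add: subgroup.m_closed subgroup.m_inv_closed)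
      then show False using a0 carX[OF cX] carX[OF a0(1)] by (simp add: a_def)
    qed
    have "\<exists>c\<in>C. x = c \<otimes> a" if x: "x \<in> X" "x \<notin> C" for x
    proof
      have "inv a \<notin> C" using aC carX[OF aX] subgroup.m_inv_closed[OF C, of "inv a"] by auto
      then show "x \<otimes> inv a \<in> C" using mult x aX subgroup.m_inv_closed[OF X(1)] by blast
      show "x = x \<otimes> inv a \<otimes> a" using carX x aX by (simp add: m_assoc)
    qed
    then show ?thesis using aX aC c(2)[folded a_def] mult[OF aX aX aC aC] by blast
  qed
  obtain a where a: "a \<in> A" "a \<notin> C" "\<And>x. x \<in> C \<Longrightarrow> a \<otimes> x = x \<otimes> a"
    "\<And>x. x \<in> A \<Longrightarrow> x \<in> C \<or> (\<exists>c\<in>C. x = c \<otimes> a)" "a \<otimes> a \<in> C"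
    using twist[OF AB(1) CA(1) two(1)] by blast
  obtain b where b: "b \<in> B" "b \<notin> C" "\<And>x. x \<in> C \<Longrightarrow> b \<otimes> x = x \<otimes> b"
    "\<And>x. x \<in> B \<Longrightarrow> x \<in> C \<or> (\<exists>c\<in>C. x = c \<otimes> b)" "b \<otimes> b \<in> C"
    using twist[OF AB(2) CA(2) two(2)] by blast
  have [simp]: "a \<in> carrier G" "b \<in> carrier G" using a b car by auto
  have Ccar [simp]: "x \<in> carrier G" if "x \<in> C" for x using that C subgroup.mem_carrier by metis
  define t \<alpha> \<zeta> where "t = a \<otimes> b" and "\<alpha> = a \<otimes> a" and "\<zeta> = a \<otimes> a \<otimes> (b \<otimes> b)"
  have t [simp]: "t \<in> carrier G" by (simp add: t_def)
  interpret dihedral_relations G C t a \<zeta> \<alpha>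
  proof
    show "finite C" using fin CA(1) finite_subset by auto
    show "\<zeta> \<in> C" unfolding \<zeta>_def using C a(5) b(5) by (rule subgroup.m_closed)
    show "t \<otimes> c = c \<otimes> t" if "c \<in> C" for c
    proof -
      have "t \<otimes> c = a \<otimes> (b \<otimes> c)" using that by (simp add: t_def m_assoc)
      also have "\<dots> = a \<otimes> c \<otimes> b" unfolding b(3)[OF that] using that by (simp add: m_assoc)
      also have "\<dots> = c \<otimes> t" unfolding a(3)[OF that] using that by (simp add: t_def m_assoc)
      finally show ?thesis .
    qed
    show "a \<otimes> t = \<zeta> \<otimes> inv t \<otimes> a"
      by (simp add: t_def \<zeta>_def inv_mult_group m_assoc)
  qed (use C a subgroup.m_closed[OF C] subgroup.one_closed[OF C] subgroup.m_inv_closed[OF C]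
      in \<open>auto simp: \<alpha>_def\<close>)
  \<comment> \<open>From \<open>b = a\<inverse> t\<close> and
    \<open>a\<inverse> = \<alpha>\<inverse> a\<close>, followed by the relation
    \<open>a_t\<close>.\<close>
  have b_nf: "b = nf (inv \<alpha> \<otimes> \<zeta>) (-1) True"
  proof -
    have "b = inv \<alpha> \<otimes> (a \<otimes> t)" by (simp add: \<alpha>_def t_def inv_mult_group m_assoc)
    then show ?thesis unfolding a_t by (simp add: nf_def int_pow_neg m_assoc)
  qed
  have AB_nf: "\<exists>c\<in>C. \<exists>k e. x = nf c k e" if x: "x \<in> A \<union> B" for x
  proof -
    consider "x \<in> C" | c where "c \<in> C" "x = c \<otimes> a" | c where "c \<in> C" "x = c \<otimes> b"
      using x a(4)[of x] b(4)[of x] by blast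
    then show ?thesis
    proof cases
      case 1
      then have "x = nf x 0 False" by (simp add: nf_def)
      then show ?thesis using 1 by blast
    next
      case 2
      then have "x = nf c 0 True" by (simp add: nf_def)
      then show ?thesis using 2 by blast
    next
      case 3
      then have "x = nf c 0 False \<otimes> b" by (simp add: nf_def)
      also have "\<dots> = nf (c \<otimes> (inv \<alpha> \<otimes> \<zeta>)) (0 + - 1) True"
        unfolding b_nf by (rule nf_mult_False) (use 3 \<zeta>_mem \<alpha>_mem in auto)
      finally have "x = nf (c \<otimes> (inv \<alpha> \<otimes> \<zeta>)) (0 + - 1) True" .
      moreover have "c \<otimes> (inv \<alpha> \<otimes> \<zeta>) \<in> C" using 3 \<zeta>_mem \<alpha>_mem by simp
      ultimately show ?thesis by blast
    qed
  qed
  have nf: "\<exists>c\<in>C. \<exists>k e. x = nf c k e" if "x \<in> generate G (A \<union> B)" for x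
    using that
  proof induction
    case one
    have "\<one> = nf \<one> 0 False" by (simp add: nf_def)
    then show ?case using C_one by blast
  next
    case (incl h)
    then show ?case by (rule AB_nf)
  next
    case (inv h)
    then have "inv h \<in> A \<union> B" by (rule invAB)
    then show ?case by (rule AB_nf)
  next
    case (eng g h)
    then obtain c k e d l f where g: "c \<in> C" "g = nf c k e" and h: "d \<in> C" "h = nf d l f" by blast
    show ?case
    proof (cases e)
      case True
      then have "g = nf c k True" using g by simp
      moreover have "c \<otimes> d \<otimes> \<zeta> [^] l \<otimes> (if f then \<alpha> else \<one>) \<in> C" using g h \<zeta>_mem \<alpha>_mem by simp
      ultimately show ?thesis using h nf_mult_True[OF g(1) h(1), of k l f] by metis
    next
      case False
      then have "g = nf c k False" using g by simp
      moreover have "c \<otimes> d \<in> C" using g h by simp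
      ultimately show ?thesis using h nf_mult_False[OF g(1) h(1), of k l f] by metis
    qed
  qed
  have "dihedral_extension G C t a \<zeta> \<alpha>"
  proof
    show "k = 0" if "t [^] k \<in> C" for k :: int
      using finite_if_t_pow_mem[OF that] nf gen assms(2) by blast
    show "\<exists>c\<in>C. \<exists>k e. x = nf c k e" if "x \<in> carrier G" for x using nf gen that by simp
  qed
  then show ?thesis using norm by blast
qed

section \<open>First-order properties of dihedral extensions\<close>

context dihedral_extension
begin

text \<open>The condition on \<open>u\<close> forces \<open>u = c t^k\<close> with
  \<open>k \<noteq> 0\<close>. An \<open>x\<close> with a factor \<open>a\<close> inverts the power
  of \<open>t\<close>, so the exponents of \<open>x u\<close> and \<open>u x\<close> would be
  \<open>l - k\<close> and \<open>k + l\<close>, which differ.\<close>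

lemma centralizer_nf:
  assumes u: "u \<in> carrier G" "u [^] (2 * card C) \<noteq> \<one>"
    and x: "x \<in> carrier G" "x \<otimes> u = u \<otimes> x"
  shows "\<exists>c\<in>C. \<exists>k::int. x = c \<otimes> t [^] k"
proof -
  obtain c k e where c: "c \<in> C" and u_nf: "u = nf c k e" using ex_nf u by blast
  have e: "\<not> e"
  proof
    assume e
    then have "u \<otimes> u = nf (c \<otimes> c \<otimes> \<zeta> [^] k \<otimes> \<alpha>) 0 False"
      using nf_mult_True[OF c c, of k k True] u_nf by simp
    then have "u \<otimes> u \<in> C" using c \<zeta>_mem \<alpha>_mem by (simp add: nf_def)
    then have "(u [^] (2::nat)) [^] card C = \<one>"
      using C_pow_card u(1) by (simp add: numeral_2_eq_2)
    then show False using u by (simp add: nat_pow_pow)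
  qed
  have k: "k \<noteq> 0"
  proof
    assume "k = 0"
    then have "u \<in> C" using u_nf c e by (simp add: nf_def)
    then have "(u [^] card C) [^] (2::nat) = \<one>" using C_pow_card by simp
    then show False using u by (simp add: nat_pow_pow mult.commute)
  qed
  obtain d l f where d: "d \<in> C" and x_nf: "x = nf d l f" using ex_nf x by blast
  have "\<not> f"
  proof
    assume f
    have "d \<otimes> c \<otimes> \<zeta> [^] k \<in> C" "c \<otimes> d \<in> C" using c d \<zeta>_mem by auto
    then have "l - k = k + l"
      using x(2) \<open>f\<close> e c d \<zeta>_mem
      by (simp add: x_nf u_nf nf_mult_True[of d c] nf_mult_False[of c d] nf_inject)
    then show False using k by simp
  qed
  then have "x = d \<otimes> t [^] l" using x_nf d by (simp add: nf_def)
  then show ?thesis using d by blast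
qed

text \<open>The power \<open>card C\<close> kills the \<open>C\<close>-part, so these powers of
  elements \<open>c t^k\<close> form an infinite cyclic group. Its properties are what the
  transferred sentences express.\<close>

lemma nf_pow_card:
  assumes "c \<in> C"
  shows "(c \<otimes> t [^] (k::int)) [^] card C = t [^] (k * int (card C))"
proof -
  have "(c \<otimes> t [^] k) [^] card C = c [^] card C \<otimes> (t [^] k) [^] card C"
    using assms t_pow_C by (intro pow_mult_distrib) auto
  then show ?thesis using C_pow_card[OF assms] by (simp add: int_pow_pow int_pow_int[symmetric])
qed

lemma nf_mult_C:
  assumes "c \<in> C" "d \<in> C"
  shows "(c \<otimes> t [^] (k::int)) \<otimes> (d \<otimes> t [^] l) = (c \<otimes> d) \<otimes> t [^] (k + l)"
  using nf_mult_False[OF assms, of k l False] assms by (simp add: nf_def)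

lemma t_pow_eq_iff: "t [^] (k::int) = t [^] l \<longleftrightarrow> k = l"
  using nf_False_inject[OF C_one C_one, of k l] by (metis int_pow_closed l_one t_closed)

lemma t_commute_nf:
  assumes "c \<in> C"
  shows "t [^] (j::int) \<otimes> (c \<otimes> t [^] (k::int)) = (c \<otimes> t [^] k) \<otimes> t [^] j"
  using nf_mult_C[OF C_one assms, of j k] nf_mult_C[OF assms C_one, of k j] assms
  by (simp add: add.commute)

lemma t_pow_2card: "t [^] (2 * card C) \<noteq> \<one>"
proof
  assume "t [^] (2 * card C) = \<one>"
  then have "t [^] int (2 * card C) = t [^] (0::int)" by (simp only: int_pow_int int_pow_0)
  then have "int (2 * card C) = 0" unfolding t_pow_eq_iff .
  then show False using card_C_pos by simp
qed

end

section \<open>Sentences about centralizers and their transfer to \<open>H\<close>\<close>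

definition gcomm :: "gterm \<Rightarrow> gterm \<Rightarrow> gform" where
  "gcomm s s' = GEq (GMul s s') (GMul s' s)"

lemma gcomm_simps [simp]:
  "feval G \<rho> (gcomm s s') \<longleftrightarrow> teval G \<rho> s \<otimes>\<^bsub>G\<^esub> teval G \<rho> s' = teval G \<rho> s' \<otimes>\<^bsub>G\<^esub> teval G \<rho> s"
  "qfree (gcomm s s')" "fvars (gcomm s s') = tvars s \<union> tvars s'"
  by (auto simp: gcomm_def)

text \<open>In a dihedral extension with \<open>N = card C\<close> the elements outside \<open>C\<langle>t\<rangle>\<close> and those of \<open>C\<close> all satisfy
  \<open>u\<^bsup>2N\<^esup> = 1\<close>; the guard thus confines \<open>x\<close> and \<open>y\<close> to \<open>C\<langle>t\<rangle>\<close> without naming \<open>C\<close> or \<open>t\<close>. Quantifying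
  universally over \<open>u\<close> is what keeps the sentences below of the form \<open>\<forall>\<exists>\<close>.\<close>
definition centralizer_guard :: "nat \<Rightarrow> gform" where
  "centralizer_guard N = GConj [GNot (GEq (gpow (GVar 0) (2 * N)) GOne),
     gcomm (GVar 1) (GVar 0), gcomm (GVar 2) (GVar 0)]"

lemma centralizer_guard_simps [simp]:
  "feval G \<rho> (centralizer_guard N) \<longleftrightarrow> \<rho> 0 [^]\<^bsub>G\<^esub> (2 * N) \<noteq> \<one>\<^bsub>G\<^esub> \<and>
     \<rho> 1 \<otimes>\<^bsub>G\<^esub> \<rho> 0 = \<rho> 0 \<otimes>\<^bsub>G\<^esub> \<rho> 1 \<and> \<rho> 2 \<otimes>\<^bsub>G\<^esub> \<rho> 0 = \<rho> 0 \<otimes>\<^bsub>G\<^esub> \<rho> 2"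
  "qfree (centralizer_guard N)" "fvars (centralizer_guard N) \<subseteq> {..<3}"
  by (simp_all add: centralizer_guard_def)

text \<open>Variables 0, 1, 2 hold \<open>u\<close>, \<open>x\<close>, \<open>y\<close> and are
  universally quantified; variable 3 is existentially quantified. With the guard as premise, a
  witness has to be found in \<open>G\<close> only where normal forms are available.\<close>

lemma transfer_centralizer_3:
  assumes AE: "AE_equiv G H" and qf: "qfree \<psi>" "fvars \<psi> \<subseteq> {..<4}"
    and G: "\<And>\<sigma>. \<lbrakk>range \<sigma> \<subseteq> carrier G; feval G \<sigma> (centralizer_guard N)\<rbrakk> \<Longrightarrow>
      \<exists>z\<in>carrier G. feval G (\<sigma>(3 := z)) \<psi>"
    and H: "u \<in> carrier H" "x \<in> carrier H" "y \<in> carrier H"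
      "u [^]\<^bsub>H\<^esub> (2 * N) \<noteq> \<one>\<^bsub>H\<^esub>" "x \<otimes>\<^bsub>H\<^esub> u = u \<otimes>\<^bsub>H\<^esub> x" "y \<otimes>\<^bsub>H\<^esub> u = u \<otimes>\<^bsub>H\<^esub> y"
  shows "\<exists>\<tau>. range \<tau> \<subseteq> carrier H \<and> \<tau> 0 = u \<and> \<tau> 1 = x \<and> \<tau> 2 = y \<and> feval H \<tau> \<psi>"
proof -
  let ?\<sigma> = "(\<lambda>_. u)(1 := x, 2 := y) :: nat \<Rightarrow> _"
  have "\<exists>\<tau>. range \<tau> \<subseteq> carrier H \<and> (\<forall>i<3. \<tau> i = ?\<sigma> i) \<and>
      feval H \<tau> (GImp (centralizer_guard N) \<psi>)"
  proof (rule AE_equiv_transfer[OF AE, where n = 4])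
    have "fvars (centralizer_guard N) \<subseteq> {..<4}"
      using centralizer_guard_simps(3)[of N] by (rule order_trans) simp
    then show "fvars (GImp (centralizer_guard N) \<psi>) \<subseteq> {..<4}"
      using qf by simp
    show "qfree (GImp (centralizer_guard N) \<psi>)" using qf by simp
    show "range ?\<sigma> \<subseteq> carrier H" using H(1-3) by (simp add: image_subset_iff)
    fix \<sigma> :: "nat \<Rightarrow> 'a" assume s: "range \<sigma> \<subseteq> carrier G"
    show "\<exists>\<tau>. range \<tau> \<subseteq> carrier G \<and> (\<forall>i<3. \<tau> i = \<sigma> i) \<and> feval G \<tau> (GImp (centralizer_guard N) \<psi>)"
    proof (cases "feval G \<sigma> (centralizer_guard N)")
      case True
      then obtain z where "z \<in> carrier G" "feval G (\<sigma>(3 := z)) \<psi>" using G s by blast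
      then show ?thesis using s by (intro exI[of _ "\<sigma>(3 := z)"]) (simp add: image_subset_iff)
    next
      case False
      then have "feval G \<sigma> (GImp (centralizer_guard N) \<psi>)" by (simp only: feval_GImp simp_thms)
      then show ?thesis using s by blast
    qed
  qed simp
  then obtain \<tau> where t: "range \<tau> \<subseteq> carrier H" "\<forall>i<3. \<tau> i = ?\<sigma> i"
      "feval H \<tau> (GImp (centralizer_guard N) \<psi>)" by blast
  have \<tau>: "\<tau> 0 = u" "\<tau> 1 = x" "\<tau> 2 = y" using t(2) by simp_all
  have "feval H \<tau> (centralizer_guard N)"
    unfolding centralizer_guard_simps(1) \<tau> using H(4-6) by blast
  then have "feval H \<tau> \<psi>" using t(3) by (simp only: feval_GImp)
  then show ?thesis using \<tau> t(1) by blast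
qed

context
  fixes G :: "('a, 'c) monoid_scheme" and H :: "('b, 'd) monoid_scheme"
    and C :: "'a set" and t a \<zeta> \<alpha> :: 'a and u x y :: 'b
  assumes ext: "dihedral_extension G C t a \<zeta> \<alpha>" and AE: "AE_equiv G H"
    and u: "u \<in> carrier H" "u [^]\<^bsub>H\<^esub> (2 * card C) \<noteq> \<one>\<^bsub>H\<^esub>"
    and x: "x \<in> carrier H" "x \<otimes>\<^bsub>H\<^esub> u = u \<otimes>\<^bsub>H\<^esub> x"
begin

interpretation dihedral_extension G C t a \<zeta> \<alpha> by (rule ext)

lemma guard_nf:
  assumes "range \<sigma> \<subseteq> carrier G" "feval G \<sigma> (centralizer_guard (card C))"
  shows "\<exists>c\<in>C. \<exists>d\<in>C. \<exists>(k::int) (l::int). \<sigma> 1 = c \<otimes>\<^bsub>G\<^esub> t [^]\<^bsub>G\<^esub> k \<and> \<sigma> 2 = d \<otimes>\<^bsub>G\<^esub> t [^]\<^bsub>G\<^esub> l"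
proof -
  have closed: "\<sigma> i \<in> carrier G" for i using assms(1) by auto
  have g: "\<sigma> 0 [^]\<^bsub>G\<^esub> (2 * card C) \<noteq> \<one>\<^bsub>G\<^esub>" "\<sigma> 1 \<otimes>\<^bsub>G\<^esub> \<sigma> 0 = \<sigma> 0 \<otimes>\<^bsub>G\<^esub> \<sigma> 1"
    "\<sigma> 2 \<otimes>\<^bsub>G\<^esub> \<sigma> 0 = \<sigma> 0 \<otimes>\<^bsub>G\<^esub> \<sigma> 2"
    using assms(2) unfolding centralizer_guard_simps(1) by blast+
  obtain c k where "c \<in> C" "\<sigma> 1 = c \<otimes>\<^bsub>G\<^esub> t [^]\<^bsub>G\<^esub> (k::int)"
    using centralizer_nf[OF closed g(1) closed g(2)] by blast
  moreover obtain d l where "d \<in> C" "\<sigma> 2 = d \<otimes>\<^bsub>G\<^esub> t [^]\<^bsub>G\<^esub> (l::int)"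
    using centralizer_nf[OF closed g(1) closed g(3)] by blast
  ultimately show ?thesis by blast
qed

text \<open>In \<open>G\<close> the guard reduces the claim to \<open>c t^k\<close> and
  \<open>d t^l\<close>, whose powers are \<open>t^(kN)\<close> and \<open>t^(lN)\<close> with
  \<open>N = card C\<close>. The claim is purely universal, so any value serves for variable
  3.\<close>

lemma transfer_pow_hom:
  assumes y: "y \<in> carrier H" "y \<otimes>\<^bsub>H\<^esub> u = u \<otimes>\<^bsub>H\<^esub> y"
  shows "(x \<otimes>\<^bsub>H\<^esub> y) [^]\<^bsub>H\<^esub> card C = x [^]\<^bsub>H\<^esub> card C \<otimes>\<^bsub>H\<^esub> y [^]\<^bsub>H\<^esub> card C \<and>
    x [^]\<^bsub>H\<^esub> card C \<otimes>\<^bsub>H\<^esub> y [^]\<^bsub>H\<^esub> card C = y [^]\<^bsub>H\<^esub> card C \<otimes>\<^bsub>H\<^esub> x [^]\<^bsub>H\<^esub> card C"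
proof -
  let ?N = "card C"
  let ?\<psi> = "GConj [GEq (gpow (GMul (GVar 1) (GVar 2)) ?N) (GMul (gpow (GVar 1) ?N) (gpow (GVar 2) ?N)),
    gcomm (gpow (GVar 1) ?N) (gpow (GVar 2) ?N)]"
  have "\<exists>\<tau>. range \<tau> \<subseteq> carrier H \<and> \<tau> 0 = u \<and> \<tau> 1 = x \<and> \<tau> 2 = y \<and> feval H \<tau> ?\<psi>"
  proof (rule transfer_centralizer_3[OF AE, where N = "card C"])
    fix \<sigma> :: "nat \<Rightarrow> 'a"
    assume "range \<sigma> \<subseteq> carrier G" "feval G \<sigma> (centralizer_guard (card C))"
    then obtain c d k l where *: "c \<in> C" "d \<in> C" "\<sigma> 1 = c \<otimes>\<^bsub>G\<^esub> t [^]\<^bsub>G\<^esub> (k::int)" "\<sigma> 2 = d \<otimes>\<^bsub>G\<^esub> t [^]\<^bsub>G\<^esub> (l::int)"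
      using guard_nf by blast
    have "(\<sigma> 1 \<otimes>\<^bsub>G\<^esub> \<sigma> 2) [^]\<^bsub>G\<^esub> ?N = t [^]\<^bsub>G\<^esub> (k * int ?N + l * int ?N)"
      "(\<sigma> 1) [^]\<^bsub>G\<^esub> ?N = t [^]\<^bsub>G\<^esub> (k * int ?N)" "(\<sigma> 2) [^]\<^bsub>G\<^esub> ?N = t [^]\<^bsub>G\<^esub> (l * int ?N)"
      using * by (simp_all add: nf_mult_C nf_pow_card distrib_right)
    then have "feval G (\<sigma>(3 := \<one>\<^bsub>G\<^esub>)) ?\<psi>"
      by (simp add: int_pow_mult[symmetric] add.commute)
    then show "\<exists>z\<in>carrier G. feval G (\<sigma>(3 := z)) ?\<psi>" by blast
  qed (use u x y in auto)
  then obtain \<tau> where "\<tau> 1 = x" "\<tau> 2 = y" and f: "feval H \<tau> ?\<psi>" by blast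
  then show ?thesis using f by simp
qed

text \<open>One sentence for each \<open>n\<close>. In \<open>G\<close> the premise says
  \<open>t^(k N n) = 1\<close>, whence \<open>k = 0\<close> and the smaller power is trivial too.
  \<open>x\<close> also fills the slot of \<open>y\<close>.\<close>

lemma transfer_torsion_free:
  assumes n: "n > 0" "x [^]\<^bsub>H\<^esub> (n * card C) = \<one>\<^bsub>H\<^esub>"
  shows "x [^]\<^bsub>H\<^esub> card C = \<one>\<^bsub>H\<^esub>"
proof -
  let ?N = "card C"
  let ?\<psi> = "GImp (GEq (gpow (GVar 1) (n * ?N)) GOne) (GEq (gpow (GVar 1) ?N) GOne)"
  have "\<exists>\<tau>. range \<tau> \<subseteq> carrier H \<and> \<tau> 0 = u \<and> \<tau> 1 = x \<and> \<tau> 2 = x \<and> feval H \<tau> ?\<psi>"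
  proof (rule transfer_centralizer_3[OF AE, where N = "card C"])
    fix \<sigma> :: "nat \<Rightarrow> 'a"
    assume "range \<sigma> \<subseteq> carrier G" "feval G \<sigma> (centralizer_guard (card C))"
    then obtain c k where *: "c \<in> C" "\<sigma> 1 = c \<otimes>\<^bsub>G\<^esub> t [^]\<^bsub>G\<^esub> (k::int)" using guard_nf by blast
    have N: "(\<sigma> 1) [^]\<^bsub>G\<^esub> ?N = t [^]\<^bsub>G\<^esub> (k * int ?N)"
      using * by (simp add: nf_pow_card)
    have "(\<sigma> 1) [^]\<^bsub>G\<^esub> (n * ?N) = ((\<sigma> 1) [^]\<^bsub>G\<^esub> ?N) [^]\<^bsub>G\<^esub> int n"
      using * by (simp add: nat_pow_pow mult.commute int_pow_int)
    also have "\<dots> = t [^]\<^bsub>G\<^esub> (k * int ?N * int n)"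
      unfolding N by (simp add: int_pow_pow)
    finally have "feval G (\<sigma>(3 := \<one>\<^bsub>G\<^esub>)) ?\<psi>"
      using N t_pow_eq_iff[of "k * int ?N * int n" 0] n(1) by (auto simp: card_C_pos)
    then show "\<exists>z\<in>carrier G. feval G (\<sigma>(3 := z)) ?\<psi>" by blast
  qed (use u x in auto)
  then obtain \<tau> where "\<tau> 1 = x" and f: "feval H \<tau> ?\<psi>" by blast
  then show ?thesis using f n(2) by simp
qed

text \<open>Among \<open>k\<close>, \<open>l\<close> and \<open>k + l\<close> at least one is even,
  say \<open>2 j\<close>; the witness in \<open>G\<close> is \<open>t^j\<close>.\<close>

lemma transfer_square:
  assumes y: "y \<in> carrier H" "y \<otimes>\<^bsub>H\<^esub> u = u \<otimes>\<^bsub>H\<^esub> y"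
  shows "\<exists>z\<in>carrier H. z \<otimes>\<^bsub>H\<^esub> u = u \<otimes>\<^bsub>H\<^esub> z \<and> (x [^]\<^bsub>H\<^esub> card C = z [^]\<^bsub>H\<^esub> (2 * card C) \<or>
    y [^]\<^bsub>H\<^esub> card C = z [^]\<^bsub>H\<^esub> (2 * card C) \<or> (x \<otimes>\<^bsub>H\<^esub> y) [^]\<^bsub>H\<^esub> card C = z [^]\<^bsub>H\<^esub> (2 * card C))"
proof -
  let ?N = "card C"
  let ?\<psi> = "GAnd (gcomm (GVar 3) (GVar 0)) (GDisj [GEq (gpow (GVar 1) ?N) (gpow (GVar 3) (2 * ?N)),
     GEq (gpow (GVar 2) ?N) (gpow (GVar 3) (2 * ?N)),
     GEq (gpow (GMul (GVar 1) (GVar 2)) ?N) (gpow (GVar 3) (2 * ?N))])"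
  have "\<exists>\<tau>. range \<tau> \<subseteq> carrier H \<and> \<tau> 0 = u \<and> \<tau> 1 = x \<and> \<tau> 2 = y \<and> feval H \<tau> ?\<psi>"
  proof (rule transfer_centralizer_3[OF AE, where N = "card C"])
    fix \<sigma> :: "nat \<Rightarrow> 'a"
    assume s: "range \<sigma> \<subseteq> carrier G" "feval G \<sigma> (centralizer_guard (card C))"
    then obtain c d k l where *: "c \<in> C" "d \<in> C" "\<sigma> 1 = c \<otimes>\<^bsub>G\<^esub> t [^]\<^bsub>G\<^esub> (k::int)" "\<sigma> 2 = d \<otimes>\<^bsub>G\<^esub> t [^]\<^bsub>G\<^esub> (l::int)"
      using guard_nf by blast
    have pw: "(\<sigma> 1 \<otimes>\<^bsub>G\<^esub> \<sigma> 2) [^]\<^bsub>G\<^esub> ?N = t [^]\<^bsub>G\<^esub> ((k + l) * int ?N)"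
      "(\<sigma> 1) [^]\<^bsub>G\<^esub> ?N = t [^]\<^bsub>G\<^esub> (k * int ?N)" "(\<sigma> 2) [^]\<^bsub>G\<^esub> ?N = t [^]\<^bsub>G\<^esub> (l * int ?N)"
      using * by (simp_all add: nf_mult_C nf_pow_card)
    obtain j where j: "k = 2 * j \<or> l = 2 * j \<or> k + l = 2 * j"
      by (metis evenE even_add)
    have tj: "(t [^]\<^bsub>G\<^esub> j) [^]\<^bsub>G\<^esub> (2 * ?N) = t [^]\<^bsub>G\<^esub> (2 * j * int ?N)"
      by (simp add: int_pow_int[symmetric] int_pow_pow mult.commute mult.left_commute)
    \<comment> \<open>\<open>\<sigma> 0\<close> commutes with itself, so
      \<open>centralizer_nf\<close> applies to it as well; thus it commutes with
      \<open>t^j\<close>.\<close>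
    obtain c0 k0 where s0: "c0 \<in> C" "\<sigma> 0 = c0 \<otimes>\<^bsub>G\<^esub> t [^]\<^bsub>G\<^esub> (k0::int)"
      using centralizer_nf[of "\<sigma> 0" "\<sigma> 0"] s by (auto simp: range_subsetD)
    have "feval G (\<sigma>(3 := t [^]\<^bsub>G\<^esub> j)) ?\<psi>"
      using j by (elim disjE) (simp_all add: pw[unfolded One_nat_def] tj s0 t_commute_nf)
    then show "\<exists>z\<in>carrier G. feval G (\<sigma>(3 := z)) ?\<psi>" by blast
  qed (use u x y in auto)
  then obtain \<tau> where t: "range \<tau> \<subseteq> carrier H" "\<tau> 0 = u" "\<tau> 1 = x" "\<tau> 2 = y" "feval H \<tau> ?\<psi>"
    by blast
  have "\<tau> 3 \<in> carrier H" using t(1) by auto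
  moreover have "\<tau> 3 \<otimes>\<^bsub>H\<^esub> u = u \<otimes>\<^bsub>H\<^esub> \<tau> 3"
    and "x [^]\<^bsub>H\<^esub> ?N = \<tau> 3 [^]\<^bsub>H\<^esub> (2 * ?N) \<or> y [^]\<^bsub>H\<^esub> ?N = \<tau> 3 [^]\<^bsub>H\<^esub> (2 * ?N) \<or>
      (x \<otimes>\<^bsub>H\<^esub> y) [^]\<^bsub>H\<^esub> ?N = \<tau> 3 [^]\<^bsub>H\<^esub> (2 * ?N)"
    using t(2-5) by simp_all
  ultimately show ?thesis by blast
qed

end

text \<open>The quantifier-free part, in the variables \<open>\<phi>(C)\<close>, \<open>s\<close>, \<open>b\<close> (to be quantified existentially) and \<open>x\<close>
  (universally), of the sentence asserting a copy of \<open>(C, t, a)\<close> in \<open>H\<close>.\<close>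
definition dihedral_witness ::
  "('a, 'c) monoid_scheme \<Rightarrow> 'a set \<Rightarrow> 'a \<Rightarrow> 'a \<Rightarrow> ('b, 'd) monoid_scheme \<Rightarrow> ('a \<Rightarrow> 'b) \<Rightarrow> 'b \<Rightarrow> 'b \<Rightarrow> 'b \<Rightarrow> bool"
where
  "dihedral_witness G C \<zeta> \<alpha> H \<phi> s b x \<longleftrightarrow>
    (\<forall>c\<in>C. \<forall>d\<in>{d \<in> C. c \<noteq> d}. \<phi> c \<noteq> \<phi> d) \<and>
    (\<forall>c\<in>C. \<forall>d\<in>C. \<phi> c \<otimes>\<^bsub>H\<^esub> \<phi> d = \<phi> (c \<otimes>\<^bsub>G\<^esub> d)) \<and>
    (\<forall>c\<in>C. s \<otimes>\<^bsub>H\<^esub> \<phi> c = \<phi> c \<otimes>\<^bsub>H\<^esub> s) \<and> (\<forall>c\<in>C. b \<otimes>\<^bsub>H\<^esub> \<phi> c = \<phi> c \<otimes>\<^bsub>H\<^esub> b) \<and>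
    b \<otimes>\<^bsub>H\<^esub> s = \<phi> \<zeta> \<otimes>\<^bsub>H\<^esub> inv\<^bsub>H\<^esub> s \<otimes>\<^bsub>H\<^esub> b \<and> b \<otimes>\<^bsub>H\<^esub> b = \<phi> \<alpha> \<and>
    s [^]\<^bsub>H\<^esub> (2 * card C) \<noteq> \<one>\<^bsub>H\<^esub> \<and>
    (x \<otimes>\<^bsub>H\<^esub> s = s \<otimes>\<^bsub>H\<^esub> x \<or> (x \<otimes>\<^bsub>H\<^esub> b) \<otimes>\<^bsub>H\<^esub> s = s \<otimes>\<^bsub>H\<^esub> (x \<otimes>\<^bsub>H\<^esub> b)) \<and>
    (x \<otimes>\<^bsub>H\<^esub> s = s \<otimes>\<^bsub>H\<^esub> x \<and> x [^]\<^bsub>H\<^esub> card C = \<one>\<^bsub>H\<^esub> \<longrightarrow> (\<exists>c\<in>C. x = \<phi> c)) \<and>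
    (x \<otimes>\<^bsub>H\<^esub> s = s \<otimes>\<^bsub>H\<^esub> x \<longrightarrow> s [^]\<^bsub>H\<^esub> card C \<noteq> x [^]\<^bsub>H\<^esub> (2 * card C)) \<and>
    (\<exists>c\<in>C. \<forall>d\<in>C. (\<phi> c \<otimes>\<^bsub>H\<^esub> x) \<otimes>\<^bsub>H\<^esub> \<phi> d = \<phi> d \<otimes>\<^bsub>H\<^esub> (\<phi> c \<otimes>\<^bsub>H\<^esub> x))"

text \<open>The clauses of \<open>dihedral_witness\<close> in the same order, with quantifiers over
  \<open>C\<close> expanded along \<open>cs\<close>. \<open>N\<close> is both the order of
  \<open>C\<close> and the index of the variable for \<open>s\<close>, as the variables below
  \<open>N\<close> stand for the elements of \<open>C\<close>.\<close>

definition dihedral_formula ::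
  "('a, 'c) monoid_scheme \<Rightarrow> 'a list \<Rightarrow> 'a \<Rightarrow> 'a \<Rightarrow> ('a \<Rightarrow> nat) \<Rightarrow> nat \<Rightarrow> gform"
where
  "dihedral_formula G cs \<zeta> \<alpha> ix N =
    (let v = \<lambda>c. GVar (ix c); s = GVar N; b = GVar (N + 1); x = GVar (N + 2) in GConj [
      GConj (map (\<lambda>c. GConj (map (\<lambda>d. GNot (GEq (v c) (v d))) (filter (\<lambda>d. c \<noteq> d) cs))) cs),
      GConj (map (\<lambda>c. GConj (map (\<lambda>d. GEq (GMul (v c) (v d)) (v (c \<otimes>\<^bsub>G\<^esub> d))) cs)) cs),
      GConj (map (\<lambda>c. gcomm s (v c)) cs), GConj (map (\<lambda>c. gcomm b (v c)) cs),
      GEq (GMul b s) (GMul (GMul (v \<zeta>) (GInv s)) b), GEq (GMul b b) (v \<alpha>),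
      GNot (GEq (gpow s (2 * N)) GOne),
      GOr (gcomm x s) (gcomm (GMul x b) s),
      GImp (GAnd (gcomm x s) (GEq (gpow x N) GOne)) (GDisj (map (\<lambda>c. GEq x (v c)) cs)),
      GImp (gcomm x s) (GNot (GEq (gpow s N) (gpow x (2 * N)))),
      GDisj (map (\<lambda>c. GConj (map (\<lambda>d. gcomm (GMul (v c) x) (v d)) cs)) cs)])"

lemma qfree_dihedral_formula: "qfree (dihedral_formula G cs \<zeta> \<alpha> ix N)"
  by (auto simp: dihedral_formula_def Let_def)

lemma fvars_dihedral_formula:
  assumes "\<And>c. c \<in> set cs \<Longrightarrow> ix c < N" "\<zeta> \<in> set cs" "\<alpha> \<in> set cs"
    "\<And>c d. \<lbrakk>c \<in> set cs; d \<in> set cs\<rbrakk> \<Longrightarrow> c \<otimes>\<^bsub>G\<^esub> d \<in> set cs"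
  shows "fvars (dihedral_formula G cs \<zeta> \<alpha> ix N) \<subseteq> {..<N + 3}"
proof -
  have *: "ix c < N + 3" if "c \<in> set cs" for c using assms(1)[OF that] by simp
  show ?thesis using *[OF assms(2)] *[OF assms(3)] *[OF assms(4)] *
    by (auto simp: dihedral_formula_def Let_def)
qed

lemma feval_dihedral_formula:
  assumes "set cs = C" "N = card C"
  shows "feval H \<tau> (dihedral_formula G cs \<zeta> \<alpha> ix N) \<longleftrightarrow>
    dihedral_witness G C \<zeta> \<alpha> H (\<lambda>c. \<tau> (ix c)) (\<tau> N) (\<tau> (N + 1)) (\<tau> (N + 2))"
  by (simp add: dihedral_formula_def dihedral_witness_def Let_def assms)

text \<open>Elements commuting with \<open>t\<close> have the form \<open>c t^k\<close>. Torsion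
  among them forces \<open>k = 0\<close>, and \<open>t^N = (c t^k)^(2N)\<close> would give
  \<open>1 = 2 k\<close>. Only the values of \<open>\<phi>\<close> on \<open>C\<close> are fixed,
  because \<open>\<phi>\<close> arises from an assignment.\<close>

lemma (in dihedral_extension) dihedral_witness_self:
  assumes inner: "\<And>x. x \<in> carrier G \<Longrightarrow> \<exists>c\<in>C. \<forall>d\<in>C. (c \<otimes> x) \<otimes> d = d \<otimes> (c \<otimes> x)"
    and \<phi>: "\<And>c. c \<in> C \<Longrightarrow> \<phi> c = c" and x: "x \<in> carrier G"
  shows "dihedral_witness G C \<zeta> \<alpha> G \<phi> t a x"
proof -
  obtain c k e where c: "c \<in> C" and x_nf: "x = nf c k e" using ex_nf x by blast
  have half: "x \<otimes> t = t \<otimes> x \<or> (x \<otimes> a) \<otimes> t = t \<otimes> (x \<otimes> a)"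
  proof (cases e)
    case False
    then have "x = c \<otimes> t [^] k" using c by (simp add: x_nf nf_def)
    then show ?thesis using t_commute_nf[OF c, of 1 k] by simp
  next
    case True
    then have "x \<otimes> a = c \<otimes> (t [^] k \<otimes> \<alpha>)" using c by (simp add: x_nf nf_def m_assoc a_a)
    also have "\<dots> = (c \<otimes> \<alpha>) \<otimes> t [^] k" using c by (simp add: t_pow_C \<alpha>_mem m_assoc)
    finally show ?thesis using t_commute_nf[of "c \<otimes> \<alpha>" 1 k] c \<alpha>_mem by simp
  qed
  have cent: "\<exists>c\<in>C. \<exists>k::int. x = c \<otimes> t [^] k" if "x \<otimes> t = t \<otimes> x"
    using centralizer_nf[OF t_closed t_pow_2card x that] .
  have tors: "x \<in> C" if x1: "x \<otimes> t = t \<otimes> x" "x [^] card C = \<one>"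
  proof -
    obtain d l where d: "d \<in> C" "x = d \<otimes> t [^] (l::int)" using cent x1 by blast
    then have "t [^] (l * int (card C)) = t [^] (0::int)" using x1 nf_pow_card by simp
    then have "l * int (card C) = 0" unfolding t_pow_eq_iff .
    then have "l = 0" using card_C_pos by simp
    then show ?thesis using d by simp
  qed
  have nosq: "t [^] card C \<noteq> x [^] (2 * card C)" if x1: "x \<otimes> t = t \<otimes> x"
  proof
    assume eq: "t [^] card C = x [^] (2 * card C)"
    obtain d l where d: "d \<in> C" "x = d \<otimes> t [^] (l::int)" using cent x1 by blast
    have "x [^] (2 * card C) = (x [^] card C) [^] (2::nat)" using x by (simp add: nat_pow_pow mult.commute)
    also have "\<dots> = (t [^] (l * int (card C))) [^] int 2"
      using d by (simp only: nf_pow_card int_pow_int)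
    also have "\<dots> = t [^] (l * int (card C) * 2)" by (simp add: int_pow_pow)
    finally have "t [^] int (card C) = t [^] (l * int (card C) * 2)" using eq by (simp add: int_pow_int)
    then have "int (card C) * 1 = int (card C) * (l * 2)"
      unfolding t_pow_eq_iff by (simp add: mult.commute mult.left_commute)
    then have "1 = l * 2" using card_C_pos by (simp only: mult_cancel_left) simp
    then show False by presburger
  qed
  have "\<forall>c\<in>C. \<forall>d\<in>{d \<in> C. c \<noteq> d}. \<phi> c \<noteq> \<phi> d" "\<forall>c\<in>C. \<forall>d\<in>C. \<phi> c \<otimes> \<phi> d = \<phi> (c \<otimes> d)"
    "\<forall>c\<in>C. t \<otimes> \<phi> c = \<phi> c \<otimes> t" "\<forall>c\<in>C. a \<otimes> \<phi> c = \<phi> c \<otimes> a"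
    "a \<otimes> t = \<phi> \<zeta> \<otimes> inv t \<otimes> a" "a \<otimes> a = \<phi> \<alpha>"
    using \<phi> \<zeta>_mem \<alpha>_mem a_t a_a t_C a_C by auto
  moreover have "\<exists>c\<in>C. \<forall>d\<in>C. (\<phi> c \<otimes> x) \<otimes> \<phi> d = \<phi> d \<otimes> (\<phi> c \<otimes> x)"
    using inner[OF x] \<phi> by auto
  moreover have "x \<otimes> t = t \<otimes> x \<and> x [^] card C = \<one> \<longrightarrow> (\<exists>c\<in>C. x = \<phi> c)"
    using tors \<phi>[of x, symmetric] by blast
  moreover have "x \<otimes> t = t \<otimes> x \<longrightarrow> t [^] card C \<noteq> x [^] (2 * card C)"
    using nosq by blast
  ultimately show ?thesis
    unfolding dihedral_witness_def using half t_pow_2card by (intro conjI) assumption+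
qed

lemma transfer_dihedral_witness:
  assumes ext: "dihedral_extension G C t a \<zeta> \<alpha>" and AE: "AE_equiv G H"
    and inner: "\<And>x. x \<in> carrier G \<Longrightarrow> \<exists>c\<in>C. \<forall>d\<in>C. (c \<otimes>\<^bsub>G\<^esub> x) \<otimes>\<^bsub>G\<^esub> d = d \<otimes>\<^bsub>G\<^esub> (c \<otimes>\<^bsub>G\<^esub> x)"
  shows "\<exists>\<phi> s b. \<phi> \<in> C \<rightarrow> carrier H \<and> s \<in> carrier H \<and> b \<in> carrier H \<and>
    (\<forall>x\<in>carrier H. dihedral_witness G C \<zeta> \<alpha> H \<phi> s b x)"
proof -
  interpret dihedral_extension G C t a \<zeta> \<alpha> by fact
  let ?N = "card C"
  obtain cs where cs: "set cs = C" using finite_list[OF C_finite] by blast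
  obtain ix0 where ix0: "bij_betw ix0 C {0..<?N}" using ex_bij_betw_finite_nat[OF C_finite] by blast
  \<comment> \<open>The default 0 keeps every index below \<open>card C\<close>, also for arguments
    outside \<open>C\<close>.\<close>
  define ix where "ix = (\<lambda>c. if c \<in> C then ix0 c else 0)"
  have ix: "bij_betw ix C {0..<?N}" using ix0 by (simp add: ix_def cong: bij_betw_cong)
  have ix_less: "ix c < ?N" for c using ix0 card_C_pos by (auto simp: ix_def bij_betw_def)
  \<comment> \<open>The assignment of the existential block in \<open>G\<close>: the enumeration of
    \<open>C\<close>, then \<open>t\<close> at \<open>card C\<close> and \<open>a\<close> at
    \<open>card C + 1\<close>. The universal variable is at \<open>card C + 2\<close>.\<close>
  define \<sigma> where "\<sigma> = (\<lambda>i. if i < ?N then inv_into C ix i else if i = ?N then t else a)"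
  have \<sigma>_ix: "\<sigma> (ix c) = c" if "c \<in> C" for c
    using ix_less[of c] inv_into_f_f[OF bij_betw_imp_inj_on[OF ix] that] by (simp add: \<sigma>_def)
  have \<sigma>_closed: "\<sigma> i \<in> carrier G" for i
    using inv_into_into[of i ix C] ix by (auto simp: \<sigma>_def bij_betw_def)
  let ?\<theta> = "dihedral_formula G cs \<zeta> \<alpha> ix ?N"
  note ev = feval_dihedral_formula[OF cs refl]
  have "\<exists>\<sigma>. range \<sigma> \<subseteq> carrier H \<and>
    (\<forall>\<tau>. range \<tau> \<subseteq> carrier H \<and> (\<forall>i<?N + 2. \<tau> i = \<sigma> i) \<longrightarrow> feval H \<tau> ?\<theta>)"
  proof (rule AE_equiv_transfer_EA[OF AE qfree_dihedral_formula])
    show "fvars ?\<theta> \<subseteq> {..<?N + 3}"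
      by (rule fvars_dihedral_formula) (use cs ix_less \<zeta>_mem \<alpha>_mem in auto)
    show "range \<sigma> \<subseteq> carrier G" using \<sigma>_closed by auto
    fix \<tau> :: "nat \<Rightarrow> 'a" assume \<tau>: "range \<tau> \<subseteq> carrier G" "\<forall>i<?N + 2. \<tau> i = \<sigma> i"
    have fix_C: "\<tau> (ix c) = c" if "c \<in> C" for c
      using \<tau>(2) \<sigma>_ix[OF that] ix_less[of c] by simp
    have ta: "\<tau> ?N = t" "\<tau> (?N + 1) = a" using \<tau>(2) by (auto simp: \<sigma>_def)
    have "\<tau> (?N + 2) \<in> carrier G" using \<tau>(1) by auto
    with inner fix_C have "dihedral_witness G C \<zeta> \<alpha> G (\<lambda>c. \<tau> (ix c)) t a (\<tau> (?N + 2))"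
      by (rule dihedral_witness_self)
    then show "feval G \<tau> ?\<theta>" by (simp only: ev ta)
  qed simp
  then obtain \<rho> where \<rho>: "range \<rho> \<subseteq> carrier H"
    "\<forall>\<tau>. range \<tau> \<subseteq> carrier H \<and> (\<forall>i<?N + 2. \<tau> i = \<rho> i) \<longrightarrow> feval H \<tau> ?\<theta>"
    by (elim exE conjE)
  have "dihedral_witness G C \<zeta> \<alpha> H (\<lambda>c. \<rho> (ix c)) (\<rho> ?N) (\<rho> (?N + 1)) x"
    if x: "x \<in> carrier H" for x
  proof -
    let ?\<tau> = "\<rho>(?N + 2 := x)"
    have "feval H ?\<tau> ?\<theta>" by (rule \<rho>(2)[rule_format]) (use \<rho>(1) x in auto)
    moreover have "?\<tau> (ix c) = \<rho> (ix c)" for c using ix_less[of c] by simp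
    moreover have "?\<tau> ?N = \<rho> ?N" "?\<tau> (?N + 1) = \<rho> (?N + 1)" "?\<tau> (?N + 2) = x" by simp_all
    ultimately show ?thesis by (simp only: ev)
  qed
  moreover have "(\<lambda>c. \<rho> (ix c)) \<in> C \<rightarrow> carrier H" using \<rho>(1) by auto
  moreover have "\<rho> ?N \<in> carrier H" "\<rho> (?N + 1) \<in> carrier H" using \<rho>(1) by auto
  ultimately show ?thesis by blast
qed

section \<open>Finitely generated models\<close>

lemma (in group) commute_mult:
  assumes "x \<in> carrier G" "y \<in> carrier G" "z \<in> carrier G" "x \<otimes> z = z \<otimes> x" "y \<otimes> z = z \<otimes> y"
  shows "x \<otimes> y \<otimes> z = z \<otimes> (x \<otimes> y)"
proof -
  have "x \<otimes> y \<otimes> z = x \<otimes> (z \<otimes> y)" using assms by (simp add: m_assoc)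
  also have "\<dots> = (z \<otimes> x) \<otimes> y" using assms(1-3) by (simp only: m_assoc[symmetric] assms(4))
  finally show ?thesis using assms(1-3) by (simp add: m_assoc)
qed

lemma (in group) subgroup_centralizer:
  assumes "g \<in> carrier G"
  shows "subgroup {x \<in> carrier G. x \<otimes> g = g \<otimes> x} G"
proof (rule subgroupI)
  show "{x \<in> carrier G. x \<otimes> g = g \<otimes> x} \<noteq> {}" using assms by (auto intro: exI[of _ g])
  fix x y assume x: "x \<in> {x \<in> carrier G. x \<otimes> g = g \<otimes> x}"
  then show "inv x \<in> {x \<in> carrier G. x \<otimes> g = g \<otimes> x}"
    using inv_commute[of x g] assms by simp
  assume "y \<in> {x \<in> carrier G. x \<otimes> g = g \<otimes> x}"
  then show "x \<otimes> y \<in> {x \<in> carrier G. x \<otimes> g = g \<otimes> x}"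
    using x commute_mult[of x y g] assms by simp
qed auto

text \<open>Here \<open>G\<close> plays the part of the model \<open>H\<close>, and
  \<open>C\<close>, \<open>t\<close>, \<open>a\<close> that of the copy found in it. The assumptions
  up to \<open>inner\<close> come from the \<open>\<exists>\<forall>\<close>-sentence;
  \<open>pow_hom\<close>, \<open>torsion_free\<close> and \<open>square\<close> come from the
  \<open>\<forall>\<exists>\<close>-sentences with \<open>u = t\<close>.\<close>

locale dihedral_model = dihedral_relations +
  assumes t_pow_2card: "t [^] (2 * card C) \<noteq> \<one>"
    and half: "x \<in> carrier G \<Longrightarrow> x \<otimes> t = t \<otimes> x \<or> (x \<otimes> a) \<otimes> t = t \<otimes> (x \<otimes> a)"
    and torsion: "\<lbrakk>x \<in> carrier G; x \<otimes> t = t \<otimes> x; x [^] card C = \<one>\<rbrakk> \<Longrightarrow> x \<in> C"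
    and not_square: "\<lbrakk>x \<in> carrier G; x \<otimes> t = t \<otimes> x\<rbrakk> \<Longrightarrow> t [^] card C \<noteq> x [^] (2 * card C)"
    and inner: "x \<in> carrier G \<Longrightarrow> \<exists>c\<in>C. \<forall>d\<in>C. (c \<otimes> x) \<otimes> d = d \<otimes> (c \<otimes> x)"
    and pow_hom: "\<lbrakk>x \<in> carrier G; x \<otimes> t = t \<otimes> x; y \<in> carrier G; y \<otimes> t = t \<otimes> y\<rbrakk> \<Longrightarrow>
      (x \<otimes> y) [^] card C = x [^] card C \<otimes> y [^] card C \<and>
      x [^] card C \<otimes> y [^] card C = y [^] card C \<otimes> x [^] card C"
    and torsion_free: "\<lbrakk>x \<in> carrier G; x \<otimes> t = t \<otimes> x; n > 0; x [^] (n * card C) = \<one>\<rbrakk> \<Longrightarrow>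
      x [^] card C = \<one>"
    and square: "\<lbrakk>x \<in> carrier G; x \<otimes> t = t \<otimes> x; y \<in> carrier G; y \<otimes> t = t \<otimes> y\<rbrakk> \<Longrightarrow>
      \<exists>z\<in>carrier G. z \<otimes> t = t \<otimes> z \<and> (x [^] card C = z [^] (2 * card C) \<or>
        y [^] card C = z [^] (2 * card C) \<or> (x \<otimes> y) [^] card C = z [^] (2 * card C))"
    and fin_gen: "fin_gen G"
begin

definition Z :: "'a set" where "Z = {x \<in> carrier G. x \<otimes> t = t \<otimes> x}"

abbreviation N :: nat where "N \<equiv> card C"

lemma Z_subgroup: "subgroup Z G"
  unfolding Z_def by (rule subgroup_centralizer) simp

lemma Z_closed [simp]: "x \<in> Z \<Longrightarrow> x \<in> carrier G"
  unfolding Z_def by (elim CollectE conjE)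

lemma Z_t: "x \<in> Z \<Longrightarrow> x \<otimes> t = t \<otimes> x"
  unfolding Z_def by (elim CollectE conjE)

lemma Z_I: "\<lbrakk>x \<in> carrier G; x \<otimes> t = t \<otimes> x\<rbrakk> \<Longrightarrow> x \<in> Z"
  unfolding Z_def by (intro CollectI conjI)

lemma Z_mult [simp]: "\<lbrakk>x \<in> Z; y \<in> Z\<rbrakk> \<Longrightarrow> x \<otimes> y \<in> Z"
  using Z_subgroup by (rule subgroup.m_closed)

lemma Z_inv [simp]: "x \<in> Z \<Longrightarrow> inv x \<in> Z"
  using Z_subgroup by (rule subgroup.m_inv_closed)

lemma Z_int_pow [simp]: "x \<in> Z \<Longrightarrow> x [^] (k::int) \<in> Z"
  by (rule subgroup_int_pow_closed[OF Z_subgroup])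

lemma C_Z: "c \<in> C \<Longrightarrow> c \<in> Z"
  by (rule Z_I[OF C_closed t_C[symmetric]])

lemma t_Z: "t \<in> Z"
  by (rule Z_I[OF t_closed refl])

lemma
  assumes "x \<in> Z" "y \<in> Z"
  shows Z_pow_mult: "(x \<otimes> y) [^] N = x [^] N \<otimes> y [^] N"
    and Z_pow_comm: "x [^] N \<otimes> y [^] N = y [^] N \<otimes> x [^] N"
proof -
  note * = pow_hom[OF Z_closed[OF assms(1)] Z_t[OF assms(1)] Z_closed[OF assms(2)] Z_t[OF assms(2)]]
  show "(x \<otimes> y) [^] N = x [^] N \<otimes> y [^] N" by (rule conjunct1[OF *])
  show "x [^] N \<otimes> y [^] N = y [^] N \<otimes> x [^] N" by (rule conjunct2[OF *])
qed

lemma C_mult_pow: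
  assumes "c \<in> C" "x \<in> Z"
  shows "(c \<otimes> x) [^] N = x [^] N"
  unfolding Z_pow_mult[OF C_Z[OF assms(1)] assms(2)] C_pow_card[OF assms(1)] using assms by simp

lemma int_pow_pow_N: "x \<in> carrier G \<Longrightarrow> (x [^] (k::int)) [^] N = (x [^] N) [^] k"
  using int_pow_pow[of x k "int N"] int_pow_pow[of x "int N" k]
  by (simp add: int_pow_int mult.commute)

text \<open>If \<open>a\<close> commuted with \<open>t\<close>, then \<open>\<zeta> = t^2\<close>
  and hence \<open>t^(2N) = 1\<close>. This makes \<open>Z\<close> a proper subgroup.\<close>

lemma a_not_Z: "a \<notin> Z"
proof
  assume "a \<in> Z"
  then have "\<zeta> \<otimes> inv t \<otimes> a = t \<otimes> a" using Z_t[of a] unfolding a_t by blast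
  then have "\<zeta> \<otimes> inv t = t" by simp
  then have "\<zeta> = t \<otimes> t" by (simp add: inv_solve_right')
  then have "\<zeta> = t [^] (2::nat)" by (simp add: numeral_2_eq_2)
  then have "t [^] (2 * N) = \<one>" using C_pow_card[OF \<zeta>_mem] by (simp add: nat_pow_pow)
  then show False using t_pow_2card by simp
qed

text \<open>Up to a factor from \<open>C\<close>, which commutes with \<open>\<zeta>\<close>, every
  \<open>x\<close> centralizes \<open>C\<close> and so commutes with \<open>\<zeta>\<close>.\<close>

lemma \<zeta>_central:
  assumes x: "x \<in> carrier G"
  shows "x \<otimes> \<zeta> = \<zeta> \<otimes> x"
proof -
  obtain c where c: "c \<in> C" "\<forall>d\<in>C. (c \<otimes> x) \<otimes> d = d \<otimes> (c \<otimes> x)" using inner[OF x] by (elim bexE)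
  have "c \<otimes> (x \<otimes> \<zeta>) = (c \<otimes> x) \<otimes> \<zeta>" using c(1) x by (simp add: m_assoc)
  also have "\<dots> = \<zeta> \<otimes> (c \<otimes> x)" by (rule bspec[OF c(2) \<zeta>_mem])
  also have "\<dots> = (\<zeta> \<otimes> c) \<otimes> x" using c(1) x by (simp add: m_assoc)
  also have "\<dots> = c \<otimes> (\<zeta> \<otimes> x)" unfolding \<zeta>_C[OF c(1)] using c(1) x by (simp add: m_assoc)
  finally show ?thesis using c(1) x by simp
qed

text \<open>The conjugate commutes with \<open>a t a\<inverse> = \<zeta> t\<inverse>\<close>; as
  \<open>\<zeta>\<close> is central, it commutes with \<open>t\<close>.\<close>

lemma conj_a_Z:
  assumes x: "x \<in> Z"
  shows "a \<otimes> x \<otimes> inv a \<in> Z"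
proof -
  define y where "y = a \<otimes> x \<otimes> inv a"
  have y: "y \<in> carrier G" using x by (simp add: y_def)
  have ata: "a \<otimes> t \<otimes> inv a = \<zeta> \<otimes> inv t" by (simp add: a_t m_assoc)
  have "y \<otimes> (a \<otimes> t \<otimes> inv a) = a \<otimes> (x \<otimes> t) \<otimes> inv a"
    using x by (simp add: y_def m_assoc)
  also have "\<dots> = (a \<otimes> t \<otimes> inv a) \<otimes> y"
    unfolding Z_t[OF x] using x by (simp add: y_def m_assoc)
  finally have "y \<otimes> \<zeta> \<otimes> inv t = \<zeta> \<otimes> inv t \<otimes> y"
    unfolding ata using y by (simp add: m_assoc)
  then have "\<zeta> \<otimes> (y \<otimes> inv t) = \<zeta> \<otimes> (inv t \<otimes> y)"
    unfolding \<zeta>_central[OF y] using y by (simp add: m_assoc)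
  then have "inv t \<otimes> y = y \<otimes> inv t" using y by simp
  then have "inv (inv t) \<otimes> y = y \<otimes> inv (inv t)"
    by (rule inv_commute[OF inv_closed[OF t_closed] y])
  then have "y \<otimes> t = t \<otimes> y" by (simp only: inv_inv t_closed)
  then show ?thesis using y unfolding y_def by (intro Z_I)
qed

lemma inv_a: "inv a = inv \<alpha> \<otimes> a"
  unfolding a_a[symmetric] by (simp add: inv_mult_group m_assoc)

text \<open>A Schreier argument for index 2. A finitely generated \<open>K \<subseteq> Z\<close>,
  stable under conjugation by \<open>a\<close>, is built so that \<open>K \<union> K a\<close>
  contains \<open>S\<close>, the inverses of its elements and all their products; hence it is the
  whole group. As \<open>a \<notin> Z\<close>, the part \<open>K a\<close> misses \<open>Z\<close>,
  so \<open>K = Z\<close>.\<close>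

lemma Z_fin_gen: "\<exists>T. finite T \<and> T \<subseteq> Z \<and> generate G T = Z"
proof -
  obtain S where S: "finite S" "S \<subseteq> carrier G" "generate G S = carrier G"
    using fin_gen by (auto simp: fin_gen_def)
  define f where "f = (\<lambda>s. if s \<in> Z then s else s \<otimes> a)"
  have fZ: "f s \<in> Z" if "s \<in> S" for s
  proof -
    have s: "s \<in> carrier G" using S that by auto
    from half[OF s] show ?thesis
    proof
      assume "s \<otimes> t = t \<otimes> s"
      then show ?thesis using Z_I[OF s] by (simp add: f_def)
    next
      assume "s \<otimes> a \<otimes> t = t \<otimes> (s \<otimes> a)"
      then have "s \<otimes> a \<in> Z" using s by (intro Z_I) auto
      then show ?thesis by (simp add: f_def)
    qed
  qed
  \<comment> \<open>The generators moved into \<open>Z\<close>, their conjugates under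
    \<open>a\<close>, and all of \<open>C\<close>. Including \<open>C\<close> lets
    \<open>\<alpha>\<close> act inside \<open>K\<close>.\<close>
  define T where "T = f ` S \<union> (\<lambda>x. a \<otimes> x \<otimes> inv a) ` f ` S \<union> C"
  have finT: "finite T" using S(1) C_finite by (simp add: T_def)
  have TZ: "T \<subseteq> Z" using fZ conj_a_Z C_Z by (auto simp: T_def)
  have T: "T \<subseteq> carrier G" using TZ by auto
  define K where "K = generate G T"
  have K: "subgroup K G" unfolding K_def using T by (rule generate_is_subgroup)
  have KZ: "K \<subseteq> Z" unfolding K_def by (rule generate_subgroup_incl[OF TZ Z_subgroup])
  have Kc: "k \<in> carrier G" if "k \<in> K" for k using KZ that by auto
  have Km: "k \<otimes> l \<in> K" if "k \<in> K" "l \<in> K" for k l using K that by (rule subgroup.m_closed)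
  have Ki: "inv k \<in> K" if "k \<in> K" for k using K that by (rule subgroup.m_inv_closed)
  have TK: "x \<in> K" if "x \<in> T" for x unfolding K_def using that by (rule generate.incl)
  have CK: "c \<in> K" if "c \<in> C" for c by (rule TK) (simp add: T_def that)
  have conjT: "a \<otimes> x \<otimes> inv a \<in> K" if xT: "x \<in> T" for x
  proof -
    consider s where "s \<in> S" "x = f s" | s where "s \<in> S" "x = a \<otimes> f s \<otimes> inv a" | "x \<in> C"
      using xT by (auto simp: T_def)
    then show ?thesis
    proof cases
      case 1
      then show ?thesis by (intro TK) (auto simp: T_def)
    next
      case 2
      have fs: "f s \<in> carrier G" "f s \<in> K" using fZ[OF 2(1)] TK 2(1) by (auto simp: T_def)
      \<comment> \<open>Conjugating twice by \<open>a\<close> is conjugation by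
        \<open>\<alpha> \<in> C\<close>, so no further generators arise.\<close>
      have "a \<otimes> x \<otimes> inv a = (a \<otimes> a) \<otimes> f s \<otimes> inv (a \<otimes> a)"
        using fs 2 by (simp add: inv_mult_group m_assoc)
      also have "\<dots> \<in> K" unfolding a_a using fs CK[OF \<alpha>_mem] by (intro Km Ki)
      finally show ?thesis .
    next
      case 3
      then have "a \<otimes> x \<otimes> inv a = x" by (simp add: a_C m_assoc)
      then show ?thesis using 3 CK by simp
    qed
  qed
  have conjK: "a \<otimes> x \<otimes> inv a \<in> K" if "x \<in> generate G T" for x
    using that
  proof induction
    case one
    then show ?case using subgroup.one_closed[OF K] by simp
  next
    case (incl h)
    then show ?case by (rule conjT)
  next
    case (inv h)
    have "inv (a \<otimes> h \<otimes> inv a) \<in> K" using conjT[OF inv] by (rule Ki)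
    moreover have "h \<in> carrier G" using inv T by auto
    ultimately show ?case by (simp add: inv_mult_group m_assoc)
  next
    case (eng g h)
    have gh: "g \<in> carrier G" "h \<in> carrier G" using eng(1,2) Kc by (auto simp: K_def)
    have "(a \<otimes> g \<otimes> inv a) \<otimes> (a \<otimes> h \<otimes> inv a) \<in> K" by (rule Km[OF eng.IH])
    then show ?case using gh by (simp add: m_assoc inv_mult_group)
  qed
  have conjK: "a \<otimes> k \<otimes> inv a \<in> K" if "k \<in> K" for k using conjK that by (simp add: K_def)
  have a_move: "a \<otimes> k = (a \<otimes> k \<otimes> inv a) \<otimes> a" if "k \<in> K" for k
    using Kc[OF that] by (simp add: m_assoc)
  have S_M: "x \<in> K \<or> (\<exists>k\<in>K. x = k \<otimes> a)" if "x \<in> S" for x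
  proof (cases "x \<in> Z")
    case True
    then have "x \<in> K" using that by (intro TK) (force simp: T_def f_def)
    then show ?thesis by simp
  next
    case False
    have x: "x \<in> carrier G" using S that by auto
    have "x \<otimes> a \<in> K" using that False by (intro TK) (force simp: T_def f_def)
    then have "x \<otimes> a \<otimes> inv \<alpha> \<in> K" by (rule Km[OF _ Ki[OF CK[OF \<alpha>_mem]]])
    moreover have "x \<otimes> a \<otimes> inv \<alpha> \<otimes> a = x \<otimes> a \<otimes> (inv \<alpha> \<otimes> a)"
      using x by (intro m_assoc) auto
    then have "x = x \<otimes> a \<otimes> inv \<alpha> \<otimes> a"
      unfolding inv_a[symmetric] using x by (simp add: m_assoc)
    ultimately show ?thesis by (intro disjI2 bexI[of _ "x \<otimes> a \<otimes> inv \<alpha>"])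
  qed
  have inv_M: "inv x \<in> K \<or> (\<exists>k\<in>K. inv x = k \<otimes> a)" if "x \<in> K \<or> (\<exists>k\<in>K. x = k \<otimes> a)" for x
    using that
  proof (elim disjE bexE)
    fix k assume k: "k \<in> K" "x = k \<otimes> a"
    have "inv x = inv \<alpha> \<otimes> (a \<otimes> inv k)"
      using k Kc by (simp add: inv_mult_group inv_a m_assoc)
    also have "a \<otimes> inv k = (a \<otimes> inv k \<otimes> inv a) \<otimes> a" by (rule a_move[OF Ki[OF k(1)]])
    also have "inv \<alpha> \<otimes> \<dots> = (inv \<alpha> \<otimes> (a \<otimes> inv k \<otimes> inv a)) \<otimes> a"
      using Kc[OF k(1)] by (simp add: m_assoc)
    finally show ?thesis using Km[OF Ki[OF CK[OF \<alpha>_mem]] conjK[OF Ki[OF k(1)]]]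
      by (intro disjI2 bexI)
  qed (blast intro: Ki)
  have M: "x \<in> K \<or> (\<exists>k\<in>K. x = k \<otimes> a)" if "x \<in> generate G S" for x
    using that
  proof induction
    case one
    then show ?case using subgroup.one_closed[OF K] by simp
  next
    case (incl h)
    then show ?case by (rule S_M)
  next
    case (inv h)
    then show ?case by (intro inv_M S_M)
  next
    case (eng g h)
    have right: "k \<otimes> h \<in> K \<or> (\<exists>k'\<in>K. k \<otimes> h = k' \<otimes> a)" if k: "k \<in> K" for k
      using eng.IH(2)
    proof (elim disjE bexE)
      fix l assume l: "l \<in> K" "h = l \<otimes> a"
      then have "k \<otimes> h = (k \<otimes> l) \<otimes> a" using k Kc by (simp add: m_assoc)
      then show ?thesis using Km[OF k l(1)] by blast
    qed (blast intro: Km k)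
    show ?case
      using eng.IH(1)
    proof (elim disjE bexE)
      fix k assume k: "k \<in> K" "g = k \<otimes> a"
      show ?thesis
        using eng.IH(2)
      proof (elim disjE bexE)
        assume h: "h \<in> K"
        have "g \<otimes> h = k \<otimes> (a \<otimes> h)" using k Kc h by (simp add: m_assoc)
        also have "\<dots> = (k \<otimes> (a \<otimes> h \<otimes> inv a)) \<otimes> a"
          using k Kc h by (simp add: m_assoc)
        finally show ?thesis using Km[OF k(1) conjK[OF h]] by blast
      next
        fix l assume l: "l \<in> K" "h = l \<otimes> a"
        have "g \<otimes> h = k \<otimes> (a \<otimes> l \<otimes> inv a) \<otimes> (a \<otimes> a)"
          using k l Kc by (simp add: m_assoc)
        also have "\<dots> \<in> K" unfolding a_a
          using Km[OF Km[OF k(1) conjK[OF l(1)]] CK[OF \<alpha>_mem]] .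
        finally show ?thesis by blast
      qed
    qed (rule right)
  qed
  have "Z \<subseteq> K"
  proof
    fix z assume z: "z \<in> Z"
    then have "z \<in> generate G S" using S(3) by simp
    from M[OF this] show "z \<in> K"
    proof (elim disjE bexE)
      fix k assume k: "k \<in> K" "z = k \<otimes> a"
      have "k \<in> Z" using k(1) KZ by auto
      then have "inv k \<otimes> z \<in> Z" using z by simp
      moreover have "inv k \<otimes> z = a" using Kc[OF k(1)] k(2) by simp
      ultimately show ?thesis using a_not_Z by simp
    qed
  qed
  then have "generate G T = Z" using KZ by (auto simp: K_def)
  then show ?thesis using finT TZ by blast
qed

text \<open>By \<open>pow_hom\<close>, \<open>x \<mapsto> x^N\<close> is a homomorphism on
  \<open>Z\<close> with abelian image. The image is finitely generated by \<open>Z_fin_gen\<close>,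
  torsion-free by \<open>torsion_free\<close>, and meets the square condition by
  \<open>square\<close>; so it is cyclic.\<close>

lemma ex_power_generator: "\<exists>s\<in>Z. \<forall>x\<in>Z. \<exists>k::int. x [^] N = (s [^] N) [^] k"
proof -
  define P where "P = (\<lambda>x. x [^] N) ` Z"
  let ?Z = "G\<lparr>carrier := Z\<rparr>" and ?P = "G\<lparr>carrier := P\<rparr>"
  interpret Zg: group ?Z by (rule subgroup_imp_group[OF Z_subgroup])
  interpret pw: group_hom ?Z G "\<lambda>x. x [^] N"
    by unfold_locales (simp add: hom_def Z_pow_mult)
  have P: "subgroup P G" using pw.img_is_subgroup by (simp add: P_def)
  interpret P: group ?P by (rule subgroup_imp_group[OF P])
  interpret P: comm_group ?P
    by unfold_locales (auto simp: P_def intro: Z_pow_comm)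
  obtain T where T: "finite T" "T \<subseteq> Z" "generate G T = Z" using Z_fin_gen by blast
  have "generate ?Z T = Z" using generate_consistent[OF T(2) Z_subgroup] T(3) by simp
  then have genP: "generate G ((\<lambda>x. x [^] N) ` T) = P" using pw.generate_img[of T] T(2) by (simp add: P_def)
  have "(\<lambda>x. x [^] N) ` T \<subseteq> P" unfolding P_def using T(2) by (rule image_mono)
  then have gen: "generate ?P ((\<lambda>x. x [^] N) ` T) = carrier ?P"
    using generate_consistent[OF _ P] genP by simp
  have "\<exists>g\<in>carrier ?P. \<forall>x\<in>carrier ?P. \<exists>k::int. x = g [^]\<^bsub>?P\<^esub> k"
  proof (rule P.cyclic_if_squares_index_le_2[OF _ _ _ gen])
    show "\<forall>x\<in>carrier ?P. \<forall>n>0::nat. x [^]\<^bsub>?P\<^esub> n = \<one>\<^bsub>?P\<^esub> \<longrightarrow> x = \<one>\<^bsub>?P\<^esub>"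
    proof (intro ballI allI impI)
      fix x and n :: nat assume x: "x \<in> carrier ?P" "n > 0" "x [^]\<^bsub>?P\<^esub> n = \<one>\<^bsub>?P\<^esub>"
      then obtain u where u: "u \<in> Z" "x = u [^] N" by (auto simp: P_def)
      have "u [^] (n * N) = \<one>"
        using x u by (simp add: nat_pow_consistent[symmetric] nat_pow_pow mult.commute)
      then show "x = \<one>\<^bsub>?P\<^esub>" using torsion_free[OF Z_closed[OF u(1)] Z_t[OF u(1)] x(2)] u(2) by simp
    qed
    show "finite ((\<lambda>x. x [^] N) ` T)" using T by simp
    show "(\<lambda>x. x [^] N) ` T \<subseteq> carrier ?P" using T by (auto simp: P_def)
    fix x y assume "x \<in> carrier ?P" "y \<in> carrier ?P"
    then obtain u v where uv: "u \<in> Z" "x = u [^] N" "v \<in> Z" "y = v [^] N" by (auto simp: P_def)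
    obtain z where z: "z \<in> Z" "u [^] N = z [^] (2 * N) \<or> v [^] N = z [^] (2 * N) \<or>
        (u \<otimes> v) [^] N = z [^] (2 * N)"
      using square[OF Z_closed[OF uv(1)] Z_t[OF uv(1)] Z_closed[OF uv(3)] Z_t[OF uv(3)]] Z_I
      by (elim bexE conjE) metis
    have "z [^] (2 * N) = z [^] N \<otimes> z [^] N" using z(1) by (simp add: nat_pow_mult mult_2)
    then show "\<exists>z\<in>carrier ?P. x = z \<otimes>\<^bsub>?P\<^esub> z \<or> y = z \<otimes>\<^bsub>?P\<^esub> z \<or> x \<otimes>\<^bsub>?P\<^esub> y = z \<otimes>\<^bsub>?P\<^esub> z"
      using z uv Z_pow_mult[OF uv(1,3)] by (intro bexI[of _ "z [^] N"]) (auto simp: P_def)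
  qed
  then obtain g where g: "g \<in> P" "\<And>x. x \<in> P \<Longrightarrow> \<exists>k::int. x = g [^]\<^bsub>?P\<^esub> k" by auto
  then obtain s where s: "s \<in> Z" "g = s [^] N" by (auto simp: P_def)
  have "\<exists>k::int. x [^] N = (s [^] N) [^] k" if "x \<in> Z" for x
  proof -
    have "x [^] N \<in> P" using that by (simp add: P_def)
    then obtain k :: int where "x [^] N = g [^]\<^bsub>?P\<^esub> k" using g(2) by blast
    then have "x [^] N = (s [^] N) [^] k" using int_pow_consistent[OF P g(1), of k] s(2) by simp
    then show ?thesis by (rule exI)
  qed
  then show ?thesis using s(1) by blast
qed

end

section \<open>Choice of a generator and recovery of the presentation\<close>

context dihedral_model
begin

text \<open>A generator \<open>s\<close> modulo \<open>C\<close> is made to centralize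
  \<open>C\<close>, then adjusted by a central element \<open>z\<close> of \<open>C\<close> until
  \<open>a\<close> acts on \<open>s z\<close> as it acts on \<open>t\<close>. The element
  \<open>t\<close> itself may be a proper odd power modulo \<open>C\<close>, so it is in general
  replaced by \<open>s z\<close>.\<close>

lemma ex_dihedral_extension: "\<exists>s. dihedral_extension G C s a \<zeta> \<alpha>"
proof -
  obtain s0 where s0: "s0 \<in> Z" and gen0: "\<forall>x\<in>Z. \<exists>k::int. x [^] N = (s0 [^] N) [^] k"
    using ex_power_generator by (elim bexE)
  obtain c0 where c0: "c0 \<in> C" and cent0: "\<forall>d\<in>C. (c0 \<otimes> s0) \<otimes> d = d \<otimes> (c0 \<otimes> s0)"
    using inner[OF Z_closed[OF s0]] by (elim bexE)
  \<comment> \<open>Left multiplication by \<open>c0\<close> makes the generator centralize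
    \<open>C\<close> and leaves its \<open>N\<close>-th power unchanged.\<close>
  define s where "s = c0 \<otimes> s0"
  have sZ: "s \<in> Z" by (simp add: s_def C_Z[OF c0] s0)
  then have s [simp]: "s \<in> carrier G" by (rule Z_closed)
  have s_C: "s \<otimes> d = d \<otimes> s" if "d \<in> C" for d using bspec[OF cent0 that] unfolding s_def .
  have sN: "s [^] N = s0 [^] N" unfolding s_def by (rule C_mult_pow[OF c0 s0])
  have sp_C: "s [^] k \<otimes> d = d \<otimes> s [^] k" if "d \<in> C" for d and k :: int
    by (rule int_pow_commute[OF s C_closed[OF that] s_C[OF that]])
  have is_C: "inv s \<otimes> d = d \<otimes> inv s" if "d \<in> C" for d
    by (rule inv_commute[OF s C_closed[OF that] s_C[OF that]])
  have decomp: "\<exists>c\<in>C. \<exists>k::int. x = c \<otimes> s [^] k" if x: "x \<in> Z" for x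
  proof -
    obtain k :: int where k: "x [^] N = (s [^] N) [^] k"
      using bspec[OF gen0 x] unfolding sN by (elim exE)
    let ?y = "x \<otimes> s [^] (- k)"
    have yZ: "?y \<in> Z" using x sZ by simp
    have "?y [^] N = x [^] N \<otimes> (s [^] (- k)) [^] N" by (rule Z_pow_mult[OF x Z_int_pow[OF sZ]])
    also have "\<dots> = (s [^] N) [^] k \<otimes> (s [^] N) [^] (- k)" by (simp only: k int_pow_pow_N[OF s])
    also have "\<dots> = \<one>" by (simp add: int_pow_mult[symmetric])
    finally have "?y \<in> C" by (rule torsion[OF Z_closed[OF yZ] Z_t[OF yZ]])
    moreover have "x = ?y \<otimes> s [^] k" using x by (simp add: m_assoc int_pow_mult[symmetric])
    ultimately show ?thesis by (intro bexI[of _ ?y] exI[of _ k])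
  qed
  \<comment> \<open>If \<open>s\<close> had finite order, \<open>torsion_free\<close> would give
    \<open>s^N = 1\<close>. Then all \<open>N\<close>-th powers of elements of \<open>Z\<close>
    would vanish, in particular that of \<open>t\<close>.\<close>
  have s_ord: "k = 0" if k: "s [^] k = \<one>" for k :: int
  proof (rule ccontr)
    assume "k \<noteq> 0"
    then have n: "nat \<bar>k\<bar> > 0" by simp
    have "s [^] \<bar>k\<bar> = \<one>" using k by (cases "k \<ge> 0") (simp_all add: int_pow_neg)
    then have "s [^] (nat \<bar>k\<bar>) = \<one>" by (metis abs_ge_zero int_nat_eq int_pow_int)
    then have "s [^] (nat \<bar>k\<bar> * N) = \<one>" by (simp add: nat_pow_pow[symmetric])
    then have s1: "s [^] N = \<one>" by (rule torsion_free[OF s Z_t[OF sZ] n])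
    obtain l :: int where "t [^] N = (s0 [^] N) [^] l" using bspec[OF gen0 t_Z] by (elim exE)
    then have "t [^] N = \<one>" using s1 sN by simp
    moreover have "t [^] (2 * N) = (t [^] N) [^] (2::nat)" by (simp add: nat_pow_pow mult.commute)
    ultimately show False using t_pow_2card by simp
  qed
  obtain c k where c: "c \<in> C" and tk: "t = c \<otimes> s [^] (k::int)"
    using decomp[OF t_Z] by (elim bexE exE)
  have tN: "t [^] N = s [^] (k * int N)"
    unfolding tk C_mult_pow[OF c Z_int_pow[OF sZ]] by (rule int_pow_nat_pow[OF s])
  \<comment> \<open>For even \<open>k\<close> the element \<open>t^N\<close> would be a
    \<open>2N\<close>-th power of a power of \<open>s\<close>, which \<open>not_square\<close>
    forbids.\<close>
  have "odd k"
  proof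
    assume "even k"
    then obtain m where m: "k = 2 * m" by (elim evenE)
    have "t [^] N = (s [^] m) [^] (2 * N)"
      unfolding tN int_pow_nat_pow[OF s] m by (simp add: mult.commute mult.left_commute)
    then show False
      using not_square[OF Z_closed[OF Z_int_pow[OF sZ]] Z_t[OF Z_int_pow[OF sZ]]] by (rule notE[rotated])
  qed
  then obtain m where m: "k = 2 * m + 1" by (elim oddE)
  \<comment> \<open>Since \<open>s\<close> centralizes \<open>C\<close>, the \<open>C\<close>-part
    of an element inherits its commutation with \<open>C\<close>. This places \<open>c\<close> and
    \<open>\<gamma>\<close> in the center of \<open>C\<close>.\<close>
  have strip: "x \<otimes> d = d \<otimes> x"
    if x: "x \<in> C" and d: "d \<in> C" and eq: "(x \<otimes> s [^] j) \<otimes> d = d \<otimes> (x \<otimes> s [^] j)" for x d and j :: int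
  proof -
    have "(x \<otimes> d) \<otimes> s [^] j = x \<otimes> (s [^] j \<otimes> d)"
      unfolding sp_C[OF d] using x d by (simp add: m_assoc)
    also have "\<dots> = (x \<otimes> s [^] j) \<otimes> d" using x d by (simp add: m_assoc)
    also have "\<dots> = (d \<otimes> x) \<otimes> s [^] j" unfolding eq using x d by (simp add: m_assoc)
    finally show ?thesis using x d by simp
  qed
  have c_C: "c \<otimes> d = d \<otimes> c" if "d \<in> C" for d
    using strip[OF c that, of k] t_C[OF that] unfolding tk by blast
  define s1 where "s1 = a \<otimes> s \<otimes> inv a"
  have s1Z: "s1 \<in> Z" unfolding s1_def by (rule conj_a_Z[OF sZ])
  obtain \<gamma> l where \<gamma>: "\<gamma> \<in> C" and s1: "s1 = \<gamma> \<otimes> s [^] (l::int)"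
    using decomp[OF s1Z] by (elim bexE exE)
  have \<gamma>_C: "\<gamma> \<otimes> d = d \<otimes> \<gamma>" if d: "d \<in> C" for d
  proof (rule strip[OF \<gamma> d])
    show "(\<gamma> \<otimes> s [^] l) \<otimes> d = d \<otimes> (\<gamma> \<otimes> s [^] l)"
      unfolding s1[symmetric] s1_def
      by (rule commute_mult[OF m_closed[OF a_closed s] inv_closed[OF a_closed] C_closed[OF d]
          commute_mult[OF a_closed s C_closed[OF d] a_C[OF d] s_C[OF d]]
          inv_commute[OF a_closed C_closed[OF d] a_C[OF d]]])
  qed
  \<comment> \<open>Both sides are \<open>a t a\<inverse>\<close>, computed from
    \<open>t = c s^k\<close> and from the relation \<open>a_t\<close>.\<close>
  have conj_t: "c \<otimes> s1 [^] k = \<zeta> \<otimes> inv t"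
  proof -
    have "c \<otimes> s1 [^] k = (c \<otimes> a) \<otimes> s [^] k \<otimes> inv a"
      unfolding s1_def conj_int_pow[OF a_closed s] using c by (simp add: m_assoc)
    also have "\<dots> = a \<otimes> t \<otimes> inv a"
      unfolding a_C[OF c, symmetric] tk using c by (simp add: m_assoc)
    also have "\<dots> = \<zeta> \<otimes> inv t" unfolding a_t by (simp add: m_assoc)
    finally show ?thesis .
  qed
  \<comment> \<open>Taking \<open>N\<close>-th powers in \<open>conj_t\<close> removes the
    \<open>C\<close>-parts; comparing exponents of \<open>s\<close> gives
    \<open>l k N = - k N\<close>, where \<open>k\<close> is odd and so nonzero.\<close>
  have l: "l = -1"
  proof -
    have s1N: "s1 [^] N = s [^] (l * int N)"
      unfolding s1 C_mult_pow[OF \<gamma> Z_int_pow[OF sZ]] by (rule int_pow_nat_pow[OF s])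
    have "(c \<otimes> s1 [^] k) [^] N = s [^] (l * int N * k)"
      unfolding C_mult_pow[OF c Z_int_pow[OF s1Z]] int_pow_pow_N[OF Z_closed[OF s1Z]] s1N
      by (rule int_pow_pow[OF s])
    moreover have "(\<zeta> \<otimes> inv t) [^] N = s [^] (- (k * int N))"
      unfolding C_mult_pow[OF \<zeta>_mem Z_inv[OF t_Z]] nat_pow_inv[OF t_closed] tN int_pow_neg[OF s] ..
    ultimately have "s [^] (l * int N * k) = s [^] (- (k * int N))" using conj_t by simp
    then have "s [^] (l * int N * k - - (k * int N)) = \<one>"
      by (simp only: int_pow_diff[OF s] r_inv int_pow_closed s)
    then have "l * int N * k - - (k * int N) = 0" by (rule s_ord)
    then have "(l + 1) * (k * int N) = 0" by (simp add: algebra_simps)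
    moreover have "k \<noteq> 0" using m by presburger
    ultimately show ?thesis using card_C_pos by simp
  qed
  have a_s: "a \<otimes> s \<otimes> inv a = \<gamma> \<otimes> inv s"
    using s1 unfolding s1_def l by (simp add: int_pow_neg)
  \<comment> \<open>Comparison of the \<open>C\<close>-parts in \<open>conj_t\<close> after
    inserting \<open>a s a\<inverse> = \<gamma> s\<inverse>\<close>.\<close>
  have \<zeta>_eq': "\<zeta> = c \<otimes> \<gamma> [^] k \<otimes> c"
  proof -
    have "s1 [^] k = \<gamma> [^] k \<otimes> inv s [^] k"
      unfolding s1_def a_s by (rule int_pow_mult_distrib) (use \<gamma> is_C[OF \<gamma>] in auto)
    then have "c \<otimes> \<gamma> [^] k \<otimes> inv s [^] k = \<zeta> \<otimes> inv t"
      using conj_t c \<gamma> by (simp add: m_assoc)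
    also have "inv t = inv s [^] k \<otimes> inv c"
      unfolding tk using c by (simp add: inv_mult_group int_pow_inv)
    also have "\<dots> = inv c \<otimes> inv s [^] k"
      using sp_C[OF C_inv[OF c], of "- k"] by (simp add: int_pow_inv int_pow_neg)
    also have "\<zeta> \<otimes> \<dots> = (\<zeta> \<otimes> inv c) \<otimes> inv s [^] k" using c by (simp add: m_assoc)
    finally have "c \<otimes> \<gamma> [^] k = \<zeta> \<otimes> inv c" using c \<gamma> by simp
    then show ?thesis using c by (simp add: m_assoc)
  qed
  define g where "g = \<gamma> [^] m"
  have g: "g \<in> C" unfolding g_def using \<gamma> by simp
  have g_C: "g \<otimes> d = d \<otimes> g" if "d \<in> C" for d
    unfolding g_def by (rule int_pow_commute[OF C_closed[OF \<gamma>] C_closed[OF that] \<gamma>_C[OF that]])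
  \<comment> \<open>As \<open>k = 2 m + 1\<close>, the expression \<open>c \<gamma>^k c\<close> is
    \<open>\<gamma>\<close> times the square of \<open>c \<gamma>^m\<close>. Oddness is what makes
    \<open>\<zeta>\<close> and \<open>\<gamma>\<close> differ by the square of a central
    element.\<close>
  define z where "z = c \<otimes> g"
  have z: "z \<in> C" unfolding z_def using c g by simp
  have z_C: "z \<otimes> d = d \<otimes> z" if d: "d \<in> C" for d
    unfolding z_def by (rule commute_mult[OF C_closed[OF c] C_closed[OF g] C_closed[OF d] c_C[OF d] g_C[OF d]])
  have \<zeta>_z: "\<zeta> = \<gamma> \<otimes> z \<otimes> z"
  proof -
    have "\<gamma> [^] k = \<gamma> \<otimes> g \<otimes> g"
    proof -
      have "\<gamma> [^] k = \<gamma> [^] (1 + m + m)" using m by simp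
      also have "\<dots> = \<gamma> [^] (1::int) \<otimes> \<gamma> [^] m \<otimes> \<gamma> [^] m"
        by (simp only: int_pow_mult C_closed[OF \<gamma>])
      finally show ?thesis using \<gamma> by (simp add: g_def)
    qed
    then have "\<zeta> = (c \<otimes> \<gamma>) \<otimes> (g \<otimes> (g \<otimes> c))"
      unfolding \<zeta>_eq' using c g \<gamma> by (simp add: m_assoc)
    also have "\<dots> = (\<gamma> \<otimes> c) \<otimes> (g \<otimes> (c \<otimes> g))"
      by (simp only: c_C[OF \<gamma>] g_C[OF c])
    finally show ?thesis unfolding z_def using c g \<gamma> by (simp add: m_assoc)
  qed
  \<comment> \<open>Now \<open>a s' a\<inverse> = \<gamma> s\<inverse> z = \<gamma> z^2 s'\<inverse>
    = \<zeta> s'\<inverse>\<close>, which is the relation required.\<close>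
  define s' where "s' = s \<otimes> z"
  have s': "s' \<in> carrier G" using z by (simp add: s'_def)
  have s'_C: "s' \<otimes> d = d \<otimes> s'" if d: "d \<in> C" for d
    unfolding s'_def by (rule commute_mult[OF s C_closed[OF z] C_closed[OF d] s_C[OF d] z_C[OF d]])
  have a_s': "a \<otimes> s' = \<zeta> \<otimes> inv s' \<otimes> a"
  proof -
    have "a \<otimes> s' = (a \<otimes> s \<otimes> inv a) \<otimes> (a \<otimes> z)" using z by (simp add: s'_def m_assoc)
    also have "\<dots> = \<gamma> \<otimes> (inv s \<otimes> z) \<otimes> a"
      unfolding a_s a_C[OF z] using z \<gamma> by (simp add: m_assoc)
    also have "\<dots> = (\<gamma> \<otimes> z \<otimes> z) \<otimes> (inv z \<otimes> inv s) \<otimes> a"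
      unfolding is_C[OF z] using z \<gamma> by (simp add: m_assoc)
    also have "\<dots> = \<zeta> \<otimes> inv s' \<otimes> a"
      unfolding \<zeta>_z[symmetric] s'_def using z by (simp add: inv_mult_group)
    finally show ?thesis .
  qed
  interpret R: dihedral_relations G C s' a \<zeta> \<alpha>
    by (intro dihedral_relations.intro dihedral_relations_axioms.intro group_axioms C_subgroup
        C_finite s' a_closed \<zeta>_mem \<alpha>_mem s'_C a_C a_s' a_a)
  have s'_pow: "s' [^] j = z [^] j \<otimes> s [^] j" for j :: int
    unfolding s'_def s_C[OF z] by (rule int_pow_mult_distrib[OF s_C[OF z, symmetric] C_closed[OF z] s])
  have s_pow: "s [^] j = z [^] (- j) \<otimes> s' [^] j" for j :: int
    unfolding s'_pow using z by (simp add: int_pow_neg)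
  have "dihedral_extension G C s' a \<zeta> \<alpha>"
  proof
    fix j :: int assume j: "s' [^] j \<in> C"
    \<comment> \<open>Passing to \<open>N\<close>-th powers reduces independence of
      \<open>s'\<close> modulo \<open>C\<close> to infinite order of \<open>s\<close>.\<close>
    have "s' [^] N = s [^] N" unfolding s'_def s_C[OF z] by (rule C_mult_pow[OF z sZ])
    then have "(s' [^] j) [^] N = (s [^] N) [^] j" by (simp only: int_pow_pow_N[OF s'])
    also have "\<dots> = s [^] (int N * j)" using int_pow_pow[OF s, of "int N" j] by (simp only: int_pow_int)
    finally have "s [^] (int N * j) = \<one>" using C_pow_card[OF j] by simp
    then have "int N * j = 0" by (rule s_ord)
    then show "j = 0" using card_C_pos by simp
  next
    fix x assume x: "x \<in> carrier G"
    have Z_nf: "\<exists>d\<in>C. \<exists>j::int. y = d \<otimes> s' [^] j" if yZ: "y \<in> Z" for y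
    proof -
      obtain d j where d: "d \<in> C" and y: "y = d \<otimes> s [^] (j::int)"
        using decomp[OF yZ] by (elim bexE exE)
      have "y = (d \<otimes> z [^] (- j)) \<otimes> s' [^] j"
        unfolding y s_pow using d z s' by (simp add: m_assoc)
      moreover have "d \<otimes> z [^] (- j) \<in> C" using d z by simp
      ultimately show ?thesis by (intro bexI exI)
    qed
    from half[OF x] show "\<exists>c\<in>C. \<exists>k e. x = R.nf c k e"
    proof
      assume xt: "x \<otimes> t = t \<otimes> x"
      obtain d j where d: "d \<in> C" "x = d \<otimes> s' [^] (j::int)"
        using Z_nf[OF Z_I[OF x xt]] by (elim bexE exE)
      then have "x = R.nf d j False" using s' by (simp add: R.nf_def)
      with d(1) show ?thesis by (intro bexI exI)
    next
      assume xat: "(x \<otimes> a) \<otimes> t = t \<otimes> (x \<otimes> a)"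
      obtain d j where d: "d \<in> C" "x \<otimes> a = d \<otimes> s' [^] (j::int)"
        using Z_nf[OF Z_I[OF m_closed[OF x a_closed] xat]] by (elim bexE exE)
      have "x = (x \<otimes> a) \<otimes> inv a" using x by (simp add: m_assoc)
      also have "\<dots> = d \<otimes> (s' [^] j \<otimes> inv \<alpha>) \<otimes> a"
        unfolding d(2) inv_a using d(1) s' by (simp add: m_assoc)
      also have "\<dots> = R.nf (d \<otimes> inv \<alpha>) j True"
        unfolding R.t_pow_C[OF C_inv[OF \<alpha>_mem]] using d(1) s' by (simp add: R.nf_def m_assoc)
      finally have "x = R.nf (d \<otimes> inv \<alpha>) j True" .
      moreover have "d \<otimes> inv \<alpha> \<in> C" using d(1) \<alpha>_mem by simp
      ultimately show ?thesis by (intro bexI exI)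
    qed
  qed
  then show ?thesis by (rule exI)
qed

end

text \<open>Injectivity and the multiplication table make \<open>\<phi>\<close> an isomorphism onto
  its image, so \<open>card C\<close> is also the order of the copy of \<open>C\<close>. The
  remaining properties are read off the witness or transferred separately.\<close>

lemma dihedral_model_of_AE_equiv:
  fixes G (structure) and H (structure)
  assumes ext: "dihedral_extension G C t a \<zeta> \<alpha>" and AE: "AE_equiv G H"
    and H: "group H" "fin_gen H"
    and \<phi>: "\<phi> \<in> C \<rightarrow> carrier H" and sb: "s \<in> carrier H" "b \<in> carrier H"
    and witness: "\<And>x. x \<in> carrier H \<Longrightarrow> dihedral_witness G C \<zeta> \<alpha> H \<phi> s b x"
  shows "\<phi> \<in> hom (G\<lparr>carrier := C\<rparr>) H" "inj_on \<phi> C"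
    "dihedral_model H (\<phi> ` C) s b (\<phi> \<zeta>) (\<phi> \<alpha>)"
proof -
  interpret G: dihedral_extension G C t a \<zeta> \<alpha> by fact
  interpret H: group H by fact
  note w = witness[unfolded dihedral_witness_def]
  \<comment> \<open>The clauses without \<open>x\<close> are extracted at
    \<open>x = \<one>\<close>.\<close>
  note w1 = w[OF H.one_closed]
  show hom: "\<phi> \<in> hom (G\<lparr>carrier := C\<rparr>) H"
    using \<phi> conjunct1[OF conjunct2[OF w1]] by (auto simp: hom_def)
  show inj: "inj_on \<phi> C" using conjunct1[OF w1] unfolding inj_on_def by auto
  have card: "card (\<phi> ` C) = card C" by (rule card_image[OF inj])
  interpret \<phi>: group_hom "G\<lparr>carrier := C\<rparr>" H \<phi>
    by (intro group_hom.intro group_hom_axioms.intro hom H.group_axioms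
        G.subgroup_imp_group[OF G.C_subgroup])
  have sub: "subgroup (\<phi> ` C) H" using \<phi>.img_is_subgroup by simp
  have s2: "s [^]\<^bsub>H\<^esub> (2 * card C) \<noteq> \<one>\<^bsub>H\<^esub>" using w1 by (elim conjE)
  show "dihedral_model H (\<phi> ` C) s b (\<phi> \<zeta>) (\<phi> \<alpha>)"
  proof (intro dihedral_model.intro dihedral_relations.intro dihedral_relations_axioms.intro
      dihedral_model_axioms.intro, unfold card)
    show "group H" "fin_gen H" by fact+
    show "subgroup (\<phi> ` C) H" by (rule sub)
    show "finite (\<phi> ` C)" using G.C_finite by simp
    show "s \<in> carrier H" "b \<in> carrier H" by fact+
    show "\<phi> \<zeta> \<in> \<phi> ` C" "\<phi> \<alpha> \<in> \<phi> ` C" using G.\<zeta>_mem G.\<alpha>_mem by auto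
    have s_\<phi>: "\<forall>c\<in>C. s \<otimes>\<^bsub>H\<^esub> \<phi> c = \<phi> c \<otimes>\<^bsub>H\<^esub> s" using w1 by (elim conjE)
    show "s \<otimes>\<^bsub>H\<^esub> c = c \<otimes>\<^bsub>H\<^esub> s" if "c \<in> \<phi> ` C" for c
      using that by (elim imageE, hypsubst) (rule bspec[OF s_\<phi>])
    have b_\<phi>: "\<forall>c\<in>C. b \<otimes>\<^bsub>H\<^esub> \<phi> c = \<phi> c \<otimes>\<^bsub>H\<^esub> b" using w1 by (elim conjE)
    show "b \<otimes>\<^bsub>H\<^esub> c = c \<otimes>\<^bsub>H\<^esub> b" if "c \<in> \<phi> ` C" for c
      using that by (elim imageE, hypsubst) (rule bspec[OF b_\<phi>])
    show "b \<otimes>\<^bsub>H\<^esub> s = \<phi> \<zeta> \<otimes>\<^bsub>H\<^esub> inv\<^bsub>H\<^esub> s \<otimes>\<^bsub>H\<^esub> b" using w1 by (elim conjE)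
    show "b \<otimes>\<^bsub>H\<^esub> b = \<phi> \<alpha>" using w1 by (elim conjE)
    show "s [^]\<^bsub>H\<^esub> (2 * card C) \<noteq> \<one>\<^bsub>H\<^esub>" by (rule s2)
  next
    fix x assume x: "x \<in> carrier H"
    show "x \<otimes>\<^bsub>H\<^esub> s = s \<otimes>\<^bsub>H\<^esub> x \<or> x \<otimes>\<^bsub>H\<^esub> b \<otimes>\<^bsub>H\<^esub> s = s \<otimes>\<^bsub>H\<^esub> (x \<otimes>\<^bsub>H\<^esub> b)"
      using w[OF x] by (elim conjE)
    have "\<exists>c\<in>C. \<forall>d\<in>C. (\<phi> c \<otimes>\<^bsub>H\<^esub> x) \<otimes>\<^bsub>H\<^esub> \<phi> d = \<phi> d \<otimes>\<^bsub>H\<^esub> (\<phi> c \<otimes>\<^bsub>H\<^esub> x)"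
      using w[OF x] by (elim conjE)
    then obtain c where c: "c \<in> C"
      and cx: "\<forall>d\<in>C. (\<phi> c \<otimes>\<^bsub>H\<^esub> x) \<otimes>\<^bsub>H\<^esub> \<phi> d = \<phi> d \<otimes>\<^bsub>H\<^esub> (\<phi> c \<otimes>\<^bsub>H\<^esub> x)"
      by (elim bexE)
    show "\<exists>c\<in>\<phi> ` C. \<forall>d\<in>\<phi> ` C. c \<otimes>\<^bsub>H\<^esub> x \<otimes>\<^bsub>H\<^esub> d = d \<otimes>\<^bsub>H\<^esub> (c \<otimes>\<^bsub>H\<^esub> x)"
    proof (intro bexI ballI)
      show "\<phi> c \<otimes>\<^bsub>H\<^esub> x \<otimes>\<^bsub>H\<^esub> d = d \<otimes>\<^bsub>H\<^esub> (\<phi> c \<otimes>\<^bsub>H\<^esub> x)" if "d \<in> \<phi> ` C" for d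
        using that by (elim imageE, hypsubst) (rule bspec[OF cx])
      show "\<phi> c \<in> \<phi> ` C" using c by (rule imageI)
    qed
  next
    fix x assume x: "x \<in> carrier H" "x \<otimes>\<^bsub>H\<^esub> s = s \<otimes>\<^bsub>H\<^esub> x"
    have "x \<otimes>\<^bsub>H\<^esub> s = s \<otimes>\<^bsub>H\<^esub> x \<longrightarrow> s [^]\<^bsub>H\<^esub> card C \<noteq> x [^]\<^bsub>H\<^esub> (2 * card C)"
      using w[OF x(1)] by (elim conjE)
    then show "s [^]\<^bsub>H\<^esub> card C \<noteq> x [^]\<^bsub>H\<^esub> (2 * card C)" using x(2) by (rule mp)
    \<comment> \<open>\<open>s\<close> itself passes the guard, so the transferred sentences apply
      to the centralizer of \<open>s\<close>.\<close>
    note u = sb(1) s2 x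
    show "x [^]\<^bsub>H\<^esub> card C = \<one>\<^bsub>H\<^esub>" if "n > 0" "x [^]\<^bsub>H\<^esub> (n * card C) = \<one>\<^bsub>H\<^esub>" for n
      by (rule transfer_torsion_free[OF ext AE u that])
    show "x \<in> \<phi> ` C" if "x [^]\<^bsub>H\<^esub> card C = \<one>\<^bsub>H\<^esub>"
    proof -
      have "x \<otimes>\<^bsub>H\<^esub> s = s \<otimes>\<^bsub>H\<^esub> x \<and> x [^]\<^bsub>H\<^esub> card C = \<one>\<^bsub>H\<^esub> \<longrightarrow> (\<exists>c\<in>C. x = \<phi> c)"
        using w[OF x(1)] by (elim conjE)
      then have "\<exists>c\<in>C. x = \<phi> c" by (rule mp[OF _ conjI[OF x(2) that]])
      then show ?thesis by auto
    qed
    fix y assume y: "y \<in> carrier H" "y \<otimes>\<^bsub>H\<^esub> s = s \<otimes>\<^bsub>H\<^esub> y"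
    show "(x \<otimes>\<^bsub>H\<^esub> y) [^]\<^bsub>H\<^esub> card C = x [^]\<^bsub>H\<^esub> card C \<otimes>\<^bsub>H\<^esub> y [^]\<^bsub>H\<^esub> card C \<and>
      x [^]\<^bsub>H\<^esub> card C \<otimes>\<^bsub>H\<^esub> y [^]\<^bsub>H\<^esub> card C = y [^]\<^bsub>H\<^esub> card C \<otimes>\<^bsub>H\<^esub> x [^]\<^bsub>H\<^esub> card C"
      by (rule transfer_pow_hom[OF ext AE u y])
    show "\<exists>z\<in>carrier H. z \<otimes>\<^bsub>H\<^esub> s = s \<otimes>\<^bsub>H\<^esub> z \<and> (x [^]\<^bsub>H\<^esub> card C = z [^]\<^bsub>H\<^esub> (2 * card C) \<or>
      y [^]\<^bsub>H\<^esub> card C = z [^]\<^bsub>H\<^esub> (2 * card C) \<or> (x \<otimes>\<^bsub>H\<^esub> y) [^]\<^bsub>H\<^esub> card C = z [^]\<^bsub>H\<^esub> (2 * card C))"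
      by (rule transfer_square[OF ext AE u y])
  qed
qed

section \<open>Rigidity under AE-equivalence and under elementary equivalence\<close>

theorem theorem8p9:
  fixes G :: "'a monoid" and H :: "'b monoid" and A B C :: "'a set"
  assumes "group G" and "infinite (carrier G)"
    and "torsion_generated G" and "virtually_cyclic G"
    and "amalgam G A B C" and "finite A" and "finite B"
    and "sub_index G A C = 2" and "sub_index G B C = 2"
    and "conj_image G C = inner_auts G C"
  shows "(group H \<and> fin_gen H \<and> elem_equiv G H \<longrightarrow> G \<cong> H)
       \<and> (group H \<and> fin_gen H \<and> AE_equiv G H \<longrightarrow> G \<cong> H)"
proof -
  have rigid: "G \<cong> H" if H: "group H" "fin_gen H" and AE: "AE_equiv G H"
  proof -
    obtain t a \<zeta> \<alpha> where ext: "dihedral_extension G C t a \<zeta> \<alpha>"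
      and norm: "C \<lhd> G"
      using amalgam_dihedral_extension[OF assms(1,2,4-6,8-10)] by blast
    obtain \<phi> s b where \<phi>: "\<phi> \<in> C \<rightarrow> carrier H" and sb: "s \<in> carrier H" "b \<in> carrier H"
      and w: "\<And>x. x \<in> carrier H \<Longrightarrow> dihedral_witness G C \<zeta> \<alpha> H \<phi> s b x"
      using transfer_dihedral_witness[OF ext AE group.ex_centralizing_mod[OF assms(1) norm assms(10)]]
      by blast
    note model = dihedral_model_of_AE_equiv[OF ext AE H \<phi> sb w]
    obtain s' where "dihedral_extension H (\<phi> ` C) s' b (\<phi> \<zeta>) (\<phi> \<alpha>)"
      using dihedral_model.ex_dihedral_extension[OF model(3)] by blast
    \<comment> \<open>\<open>G\<close> and \<open>H\<close> are now extensions with data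
      \<open>(C, \<zeta>, \<alpha>)\<close> and its image under \<open>\<phi>\<close>.\<close>
    then show ?thesis
      using dihedral_extension_iso[OF ext _ model(1) inj_on_imp_bij_betw[OF model(2)] refl refl]
      by blast
  qed
  \<comment> \<open>AE-sentences are sentences, so elementary equivalence reduces to the case just
    settled.\<close>
  moreover have "AE_equiv G H" if "elem_equiv G H"
    using that by (auto simp: elem_equiv_def AE_equiv_def AE_sentence_def)
  ultimately show ?thesis by blast
qed

end
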